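(* The six classes $\mathcal F_s$ for $s\in\{=,\neq,\le_R,\ge_R,\le_C,\ge_C\}$ are precisely all the classes $\mathcal M$ of $0,1$-matrices (closed under taking submatrices) with growth $2^{\omega(n)}$ such that every proper subclass of $\mathcal M$ (closed under taking submatrices) has growth $2^{O(n)}$.
   Context: A matrix has finite totally ordered sets of rows and columns, and matrices are considered up to order-preserving isomorphism of rows and columns. A class of matrices is by definition closed under taking submatrices (deleting rows and columns). The growth of a class maps $n$ to the number of $n\times n$ matrices in it. Growth $2^{\omega(n)}$ means that it equals $2^{f(n)}$ for some function $f$ with $f(n)/n\to\infty$. For a permutation $\sigma$ of $[n]$ let $F_s(\sigma)$ be the $n\times n$ $0,1$-matrix whose entry at row $i$, column $j$ is $1$ iff, respectively: $\sigma(i)=j$ (for $s$ being $=$); $\sigma(i)\neq j$ ($\neq$); $i\le\sigma^{-1}(j)$ ($\le_R$); $i\ge\sigma^{-1}(j)$ ($\ge_R$); $j\le\sigma(i)$ ($\le_C$); $j\ge\sigma(i)$ ($\ge_C$). $\mathcal F_s$ is the set of all submatrices of the matrices $F_s(\sigma)$, over all $n\ge1$ and all permutations $\sigma$ of $[n]$. *)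

theory Defs
  imports
    "Jordan_Normal_Form.DL_Submatrix"
    "HOL-Combinatorics.Permutations"
    "HOL-Library.Landau_Symbols"
begin

text \<open>
  The type \<^typ>\<open>'a mat\<close> indexes rows and columns by initial segments of the naturals, so it has
  exactly one element for each matrix (with finite totally ordered row and column sets) up to
  order-preserving isomorphism. Matrices without rows or without columns are included. In
  \<^term>\<open>submatrix A I J\<close> the sets \<^term>\<open>I\<close> and \<^term>\<open>J\<close> are the rows and columns that are kept;
  indices outside the range of \<^term>\<open>A\<close> are ignored.
\<close>

definition matrix_class :: "'a mat set \<Rightarrow> bool" where
  "matrix_class M \<longleftrightarrow> (\<forall>A\<in>M. \<forall>I J. submatrix A I J \<in> M)"

definition zero_one_mat :: "nat mat \<Rightarrow> bool" where
  "zero_one_mat A \<longleftrightarrow> elements_mat A \<subseteq> {0, 1}"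

definition growth :: "'a mat set \<Rightarrow> nat \<Rightarrow> nat" where
  "growth M n = card (M \<inter> carrier_mat n n)"

definition growth_exp_superlinear :: "'a mat set \<Rightarrow> bool" where
  "growth_exp_superlinear M \<longleftrightarrow>
     (\<exists>f :: nat \<Rightarrow> real. (\<forall>n. real (growth M n) = 2 powr f n) \<and>
        filterlim (\<lambda>n. f n / real n) at_top sequentially)"

text \<open>
  The upper bound is an inequality, since a class with bounded dimensions has growth 0 for large n.
\<close>

definition growth_exp_linear :: "'a mat set \<Rightarrow> bool" where
  "growth_exp_linear M \<longleftrightarrow>
     (\<exists>f :: nat \<Rightarrow> real. f \<in> O(\<lambda>n. real n) \<and> (\<forall>n. real (growth M n) \<le> 2 powr f n))"

datatype kind = Eq | Neq | LeR | GeR | LeC | GeC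

text \<open>
  Rows and columns of an n by n matrix are numbered from 0 to n - 1 and \<^term>\<open>\<sigma>\<close> is a permutation
  of this range (its inverse is \<^term>\<open>inv_into UNIV \<sigma>\<close>); shifting all indices by one does
  not affect any of the six conditions.
\<close>

fun entry_one :: "kind \<Rightarrow> (nat \<Rightarrow> nat) \<Rightarrow> nat \<Rightarrow> nat \<Rightarrow> bool" where
  "entry_one Eq  \<sigma> i j \<longleftrightarrow> \<sigma> i = j"
| "entry_one Neq \<sigma> i j \<longleftrightarrow> \<sigma> i \<noteq> j"
| "entry_one LeR \<sigma> i j \<longleftrightarrow> i \<le> inv_into UNIV \<sigma> j"
| "entry_one GeR \<sigma> i j \<longleftrightarrow> i \<ge> inv_into UNIV \<sigma> j"
| "entry_one LeC \<sigma> i j \<longleftrightarrow> j \<le> \<sigma> i"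
| "entry_one GeC \<sigma> i j \<longleftrightarrow> j \<ge> \<sigma> i"

definition perm_mat :: "kind \<Rightarrow> nat \<Rightarrow> (nat \<Rightarrow> nat) \<Rightarrow> nat mat" where
  "perm_mat s n \<sigma> = mat n n (\<lambda>(i, j). if entry_one s \<sigma> i j then 1 else 0)"

definition perm_class :: "kind \<Rightarrow> nat mat set" where
  "perm_class s = {submatrix (perm_mat s n \<sigma>) I J | n \<sigma> I J. n \<ge> 1 \<and> \<sigma> permutes {0..<n}}"

end

theory Submission
  imports Defs "HOL-Library.Ramsey"
begin

text \<open>
  The heart of the matter is a dichotomy (\<open>growth_dichotomy\<close>): a class of 0,1-matrices that contains
  none of the six classes has growth \<open>2^(O(n))\<close>. Each of the six classes has growth at least \<open>n!\<close>, since
  a matrix of a permutation determines the permutation, and none of them is included in another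
  (\<open>perm_class_antichain\<close>). So a proper subclass of one of the six contains none of the six and has
  growth \<open>2^(O(n))\<close>, and a class of growth \<open>2^(\<omega>(n))\<close> contains one of the six, hence equals it if it is
  minimal.

  The dichotomy is governed by rich divisions: a k-rich division cuts a matrix into k by k cells,
  each of which has at least k distinct columns.

  If a class has k-rich divisions for all k, Ramsey arguments find one of the six families in it
  (\<open>rich_division_realizes\<close>). Inside a cell, many distinct columns give a large identity,
  co-identity or half graph. A product Ramsey theorem then makes the interaction of different cells
  uniform: whether a row of one cell has a 1 in a column of another cell depends only on the relative
  position of the two cells and on the labels of the row and the column. If the relative position
  matters, one of the four order types \<open>\<le>\<^sub>R, \<ge>\<^sub>R, \<le>\<^sub>C, \<ge>\<^sub>C\<close> can be read off. If it does not, then either a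
  cell differs from its surroundings in some entry, which gives \<open>=\<close> or \<open>\<noteq>\<close>, or the entries depend on
  the labels only, and the labels themselves can be used to write down an arbitrary permutation.
  Rich divisions in the transposed matrices are equally good, since transposition permutes the six
  families.

  If a class and its transpose have no k-rich division for some k, its growth is bounded by a
  recursion (\<open>poor_class_growth\<close>). Cut a matrix into square blocks of constant side L. By the
  Marcus-Tardos theorem for grids, only linearly many blocks are rich, that is, have k distinct
  columns, and only linearly many other blocks are fresh, that is, contain a column that has not
  occurred before in a non-rich block of the same row of blocks: large grids of either kind of
  block would yield a rich division. A row of blocks with few fresh blocks has boundedly many column
  types outside the rich blocks, so two of its L rows agree there, and one of the two can be
  reconstructed from the other and the contents of the rich blocks. By Klazar's counting argument, the
  position of the rich blocks costs only O(n) bits. Hence a constant fraction of the rows, and by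
  transposition of the columns, can be deleted at the price of O(n) bits, and summing the resulting
  geometric series gives \<open>2^(O(n))\<close>.
\<close>

section \<open>Point sets without a large grid\<close>

text \<open>
  The parts of the division are the intervals between consecutive values of monotone sequences, so
  they may be empty or reach beyond all points. This frees later constructions from boundary
  conditions.
\<close>

definition has_grid :: "nat \<Rightarrow> (nat \<times> nat) set \<Rightarrow> bool" where
  "has_grid k P \<longleftrightarrow> (\<exists>r c. mono r \<and> mono c \<and>
     (\<forall>a<k. \<forall>b<k. \<exists>(i, j)\<in>P. r a \<le> i \<and> i < r (Suc a) \<and> c b \<le> j \<and> j < c (Suc b)))"

lemma has_gridI:
  assumes "mono r" "mono c"
    and "\<And>a b. a < k \<Longrightarrow> b < k \<Longrightarrow>
      \<exists>i j. (i, j) \<in> P \<and> r a \<le> i \<and> i < r (Suc a) \<and> c b \<le> j \<and> j < c (Suc b)"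
  shows "has_grid k P"
  unfolding has_grid_def using assms by (intro exI[of _ r] exI[of _ c]) fast

lemma has_gridE:
  assumes "has_grid k P"
  obtains r c where "mono r" "mono c"
    "\<And>a b. a < k \<Longrightarrow> b < k \<Longrightarrow>
      \<exists>i j. (i, j) \<in> P \<and> r a \<le> i \<and> i < r (Suc a) \<and> c b \<le> j \<and> j < c (Suc b)"
  using assms unfolding has_grid_def by fast

lemma has_grid_converse:
  assumes "has_grid k (P\<inverse>)"
  shows "has_grid k P"
proof -
  from assms obtain r c where rc: "mono r" "mono c"
    and pt: "\<And>a b. a < k \<Longrightarrow> b < k \<Longrightarrow>
      \<exists>i j. (i, j) \<in> P\<inverse> \<and> r a \<le> i \<and> i < r (Suc a) \<and> c b \<le> j \<and> j < c (Suc b)"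
    by (rule has_gridE) blast
  show ?thesis
    by (rule has_gridI[OF rc(2,1)]) (use pt in blast)
qed

abbreviation contract :: "nat \<Rightarrow> (nat \<times> nat) set \<Rightarrow> (nat \<times> nat) set" where
  "contract s P \<equiv> (\<lambda>(i, j). (i div s, j div s)) ` P"

text \<open>
  Blowing up a division of the contracted set by the factor s sends a part to a union of blocks, so it
  keeps hitting points.
\<close>

lemma has_grid_contract:
  assumes "has_grid k (contract s P)" and "s > 0"
  shows "has_grid k P"
proof -
  from assms(1) obtain r c where rc: "mono r" "mono c"
    and pt: "\<And>a b. a < k \<Longrightarrow> b < k \<Longrightarrow>
      \<exists>i j. (i, j) \<in> contract s P \<and> r a \<le> i \<and> i < r (Suc a) \<and> c b \<le> j \<and> j < c (Suc b)"
    by (rule has_gridE) blast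
  have le: "x * s \<le> i \<longleftrightarrow> x \<le> i div s" "i < x * s \<longleftrightarrow> i div s < x" for x i
    using \<open>s > 0\<close> by (simp_all add: less_eq_div_iff_mult_less_eq div_less_iff_less_mult)
  show ?thesis
  proof (rule has_gridI[where r = "\<lambda>a. r a * s" and c = "\<lambda>b. c b * s"])
    show "mono (\<lambda>a. r a * s)" "mono (\<lambda>b. c b * s)"
      using rc by (auto simp: mono_def)
  next
    fix a b assume "a < k" "b < k"
    from pt[OF this] obtain i j where "(i, j) \<in> P" "r a \<le> i div s" "i div s < r (Suc a)"
        "c b \<le> j div s" "j div s < c (Suc b)"
      by auto
    then show "\<exists>i j. (i, j) \<in> P \<and> r a * s \<le> i \<and> i < r (Suc a) * s
        \<and> c b * s \<le> j \<and> j < c (Suc b) * s"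
      unfolding le by blast
  qed
qed

text \<open>
  A part starts at each of the given positions; the last part ends behind their maximum.
\<close>

lemma separating_sequence:
  assumes "finite (X :: nat set)" and "k \<le> card X"
  obtains e where "mono e" "\<And>a. a < k \<Longrightarrow> \<exists>x\<in>X. e a \<le> x \<and> x < e (Suc a)"
proof -
  obtain h where bij: "bij_betw h {..<card X} X" and sm: "strict_mono_on {..<card X} h"
    using ex_bij_betw_strict_mono_card[OF assms(1)] by blast
  define e where "e a = (if a < card X then h a else Suc (Max X))" for a
  have hX: "h a \<in> X" if "a < card X" for a
    using bij that by (auto simp: bij_betw_def)
  have step: "h a < e (Suc a)" if "a < card X" for a
  proof (cases "Suc a < card X")
    case True
    then show ?thesis using sm that unfolding e_def strict_mono_on_def by auto
  next
    case False
    then show ?thesis using Max_ge[OF assms(1) hX[OF that]] by (simp add: e_def)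
  qed
  have "mono e"
  proof (rule monoI)
    fix a b :: nat assume "a \<le> b"
    show "e a \<le> e b"
    proof (cases "b < card X")
      case True
      then show ?thesis using sm \<open>a \<le> b\<close> unfolding e_def strict_mono_on_def
        by (cases "a = b") (auto intro!: less_imp_le)
    next
      case False
      then show ?thesis using Max_ge[OF assms(1) hX[of a]] by (auto simp: e_def)
    qed
  qed
  moreover have "\<exists>x\<in>X. e a \<le> x \<and> x < e (Suc a)" if "a < k" for a
    using step[of a] hX[of a] that assms(2) by (intro bexI[of _ "h a"]) (auto simp: e_def)
  ultimately show ?thesis using that by blast
qed

lemma has_grid_mono:
  assumes "has_grid k P" and "l \<le> k" and "P \<subseteq> Q"
  shows "has_grid l Q"
  using assms(1)
proof (rule has_gridE)
  fix r c assume rc: "mono r" "mono c" and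
    pt: "\<And>a b. a < k \<Longrightarrow> b < k \<Longrightarrow>
      \<exists>i j. (i, j) \<in> P \<and> r a \<le> i \<and> i < r (Suc a) \<and> c b \<le> j \<and> j < c (Suc b)"
  show ?thesis
    by (rule has_gridI[OF rc]) (use pt assms(2,3) in \<open>meson less_le_trans subsetD\<close>)
qed

definition block :: "nat \<Rightarrow> nat \<Rightarrow> nat set" where
  "block s I = {i. i div s = I}"

lemma mem_block [simp]: "i \<in> block s I \<longleftrightarrow> i div s = I"
  by (simp add: block_def)

lemma block_eq: "s > 0 \<Longrightarrow> block s I = {I * s..<I * s + s}"
proof -
  assume "s > 0"
  have "i div s = I \<longleftrightarrow> I * s \<le> i \<and> i < Suc I * s" for i
    unfolding less_eq_div_iff_mult_less_eq[OF \<open>s > 0\<close>, symmetric]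
      div_less_iff_less_mult[OF \<open>s > 0\<close>, symmetric] by auto
  then show ?thesis
    by (simp only: set_eq_iff mem_block atLeastLessThan_iff mult_Suc add.commute) blast
qed

lemma card_block: "s > 0 \<Longrightarrow> card (block s I) = s" and finite_block: "s > 0 \<Longrightarrow> finite (block s I)"
  by (simp_all add: block_eq)

text \<open>
  Width is measured by the number of nonempty columns in a block; the tall blocks of P are the wide
  blocks of its converse.
\<close>

definition wide_blocks :: "nat \<Rightarrow> nat \<Rightarrow> (nat \<times> nat) set \<Rightarrow> (nat \<times> nat) set" where
  "wide_blocks k s P = {(I, J). k < card (snd ` (P \<inter> block s I \<times> block s J))}"

text \<open>
  Among very many wide blocks in the same column of blocks, by the pigeonhole principle more than k
  have the same set of nonempty columns. These blocks, taken as row parts, and columns of that set,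
  taken as column parts, form a grid.
\<close>

lemma wide_blocks_in_column:
  assumes s: "s > 0" and ng: "\<not> has_grid (Suc k) P"
  shows "finite {I. (I, J) \<in> wide_blocks k s P} \<and> card {I. (I, J) \<in> wide_blocks k s P} \<le> Suc k * 2 ^ s"
proof (rule ccontr)
  let ?W = "{I. (I, J) \<in> wide_blocks k s P}"
  define cols where "cols I = snd ` (P \<inter> block s I \<times> block s J)" for I
  have cols_sub: "cols I \<in> Pow (block s J)" for I by (auto simp: cols_def)
  have fin: "finite (Pow (block s J))" and cardPow: "card (Pow (block s J)) = 2 ^ s"
    using s by (simp_all add: card_Pow finite_block card_block)
  assume neg: "\<not> (finite ?W \<and> card ?W \<le> Suc k * 2 ^ s)"
  obtain W where W: "finite W" "W \<subseteq> ?W" "Suc k * 2 ^ s < card W"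
  proof (cases "finite ?W")
    case True
    with neg that[of ?W] show ?thesis by auto
  next
    case False
    from infinite_arbitrarily_large[OF this, of "Suc (Suc k * 2 ^ s)"] that show ?thesis
      by (metis lessI)
  qed
  have "\<exists>S\<in>Pow (block s J). Suc k < card {I \<in> W. cols I = S}"
  proof (rule ccontr)
    assume "\<not> ?thesis"
    then have small: "card {I \<in> W. cols I = S} \<le> Suc k" if "S \<in> Pow (block s J)" for S
      using that by (meson leI)
    have "card W \<le> card (\<Union>S\<in>Pow (block s J). {I \<in> W. cols I = S})"
    proof (rule card_mono)
      show "finite (\<Union>S\<in>Pow (block s J). {I \<in> W. cols I = S})"
        using W(1) fin by (intro finite_UN_I) simp_all
      show "W \<subseteq> (\<Union>S\<in>Pow (block s J). {I \<in> W. cols I = S})" using cols_sub by blast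
    qed
    also have "\<dots> \<le> (\<Sum>S\<in>Pow (block s J). card {I \<in> W. cols I = S})"
      by (rule card_UN_le[OF fin])
    also have "\<dots> \<le> (\<Sum>S\<in>Pow (block s J). Suc k)"
      by (intro sum_mono small)
    also have "\<dots> = Suc k * 2 ^ s"
      by (simp only: sum_constant cardPow) simp
    finally show False using W(3) by simp
  qed
  then obtain S where S: "Suc k < card {I \<in> W. cols I = S}" by blast
  let ?X = "{I \<in> W. cols I = S}"
  have finX: "finite ?X" using W(1) by simp
  from S have "?X \<noteq> {}" by (metis card.empty not_less_zero)
  then obtain I where I: "I \<in> W" "cols I = S" by blast
  then have cardS: "Suc k \<le> card S" using W(2) by (auto simp: wide_blocks_def cols_def)
  then have finS: "finite S" by (metis card.infinite not_less_eq_eq zero_le)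
  obtain r where r: "mono r" "\<And>a. a < Suc k \<Longrightarrow> \<exists>I\<in>?X. r a \<le> I \<and> I < r (Suc a)"
    using separating_sequence[OF finX less_imp_le[OF S]] by blast
  obtain c where c: "mono c" "\<And>a. a < Suc k \<Longrightarrow> \<exists>j\<in>S. c a \<le> j \<and> j < c (Suc a)"
    using separating_sequence[OF finS cardS] by blast
  have "has_grid (Suc k) P"
  proof (rule has_gridI[where r = "\<lambda>a. r a * s" and c = c])
    show "mono (\<lambda>a. r a * s)" using r(1) by (auto simp: mono_def)
    show "mono c" by (rule c)
    fix a b assume "a < Suc k" "b < Suc k"
    from r(2)[OF this(1)] obtain I where I: "I \<in> ?X" "r a \<le> I" "I < r (Suc a)" by blast
    from c(2)[OF \<open>b < Suc k\<close>] obtain j where j: "j \<in> S" "c b \<le> j" "j < c (Suc b)" by blast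
    from I(1) j(1) have "j \<in> cols I" by simp
    then obtain i where i: "(i, j) \<in> P" "i div s = I" by (auto simp: cols_def)
    with I s have "r a * s \<le> i" "i < r (Suc a) * s"
      by (simp_all add: less_eq_div_iff_mult_less_eq[symmetric] div_less_iff_less_mult[symmetric])
    with i j show "\<exists>i j. (i, j) \<in> P \<and> r a * s \<le> i \<and> i < r (Suc a) * s \<and> c b \<le> j \<and> j < c (Suc b)"
      by blast
  qed
  with ng show False by contradiction
qed

lemma card_wide_blocks:
  assumes s: "s > 0" and ng: "\<not> has_grid (Suc k) P" and P: "P \<subseteq> {..<n * s} \<times> {..<n * s}"
  shows "finite (wide_blocks k s P) \<and> card (wide_blocks k s P) \<le> n * (Suc k * 2 ^ s)"
proof -
  let ?W = "\<lambda>J. {I. (I, J) \<in> wide_blocks k s P}"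
  have "wide_blocks k s P \<subseteq> (\<Union>J\<in>{..<n}. ?W J \<times> {J})"
  proof (rule subrelI)
    fix I J assume IJ: "(I, J) \<in> wide_blocks k s P"
    then have "\<exists>x. x \<in> P \<inter> block s I \<times> block s J"
      unfolding ex_in_conv
      unfolding wide_blocks_def by (metis (no_types, lifting) card.empty case_prodD image_empty mem_Collect_eq not_less_zero)
    then obtain i j where "(i, j) \<in> P" "j div s = J" by (metis IntE SigmaE2 mem_block surj_pair)
    with P s have "J < n" by (auto simp: div_less_iff_less_mult)
    with IJ show "(I, J) \<in> (\<Union>J\<in>{..<n}. ?W J \<times> {J})" by auto
  qed
  moreover have fin: "finite (\<Union>J\<in>{..<n}. ?W J \<times> {J})"
    using wide_blocks_in_column[OF s ng] by auto
  ultimately have "finite (wide_blocks k s P)"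
    and "card (wide_blocks k s P) \<le> card (\<Union>J\<in>{..<n}. ?W J \<times> {J})"
    by (auto intro: finite_subset card_mono)
  note this(2)
  also have "\<dots> \<le> (\<Sum>J<n. card (?W J \<times> {J}))"
    by (rule card_UN_le) simp
  also have "\<dots> \<le> (\<Sum>J<n. Suc k * 2 ^ s)"
    using wide_blocks_in_column[OF s ng] by (intro sum_mono) (simp add: card_cartesian_product)
  finally show ?thesis using \<open>finite (wide_blocks k s P)\<close> by simp
qed

text \<open>
  The Marcus-Tardos recursion. With blocks of side s = (k+1)^2, a block that is neither wide nor tall
  has at most k^2 points, and the nonempty blocks form a set without grid by themselves. So the number
  of points grows by a factor of at most k^2 when the side grows by a factor of (k+1)^2, apart from a
  linear contribution of the wide and the tall blocks. As k^2 < (k+1)^2, the linear term prevails.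
\<close>

lemma grid_free_power_bound:
  assumes s: "s = Suc k * Suc k"
  shows "P \<subseteq> {..<s ^ t} \<times> {..<s ^ t} \<Longrightarrow> \<not> has_grid (Suc k) P
    \<Longrightarrow> card P \<le> Suc (2 * (s * s) * (Suc k * 2 ^ s)) * s ^ t"
proof (induction t arbitrary: P)
  case 0
  then have "card P \<le> card {(0::nat, 0::nat)}" by (intro card_mono) auto
  then show ?case by simp
next
  case (Suc t)
  define d where "d = Suc k * 2 ^ s"
  define D where "D = Suc (2 * (s * s) * d)"
  have s0: "s > 0" using s by simp
  let ?C = "contract s P" and ?W = "wide_blocks k s P" and ?V = "(wide_blocks k s (P\<inverse>))\<inverse>"
  let ?cell = "\<lambda>(I, J). P \<inter> block s I \<times> block s J"
  have P: "P \<subseteq> {..<s ^ t * s} \<times> {..<s ^ t * s}" and ng: "\<not> has_grid (Suc k) P"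
    using Suc.prems by (simp_all add: mult.commute)
  have finP: "finite P" using P by (rule finite_subset) simp
  have CW: "finite ?C" using finP by simp
  have W: "finite ?W" "card ?W \<le> s ^ t * d"
    using card_wide_blocks[OF s0 ng P] by (simp_all add: d_def)
  have "\<not> has_grid (Suc k) (P\<inverse>)" "P\<inverse> \<subseteq> {..<s ^ t * s} \<times> {..<s ^ t * s}"
    using P ng has_grid_converse[of "Suc k" P] by auto
  from card_wide_blocks[OF s0 this] have V: "finite ?V" "card ?V \<le> s ^ t * d"
    by (simp_all add: d_def)
  have C: "card ?C \<le> D * s ^ t"
  proof -
    have "?C \<subseteq> {..<s ^ t} \<times> {..<s ^ t}"
      using P s0 by (auto simp: div_less_iff_less_mult)
    moreover have "\<not> has_grid (Suc k) ?C"
      using ng has_grid_contract s0 by blast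
    ultimately show ?thesis using Suc.IH unfolding D_def d_def by blast
  qed
  have cell_le: "card (?cell x) \<le> s * s" for x
  proof -
    have "card (?cell x) \<le> card (block s (fst x) \<times> block s (snd x))"
      using s0 by (intro card_mono) (auto simp: finite_block)
    then show ?thesis using s0 by (simp add: card_cartesian_product card_block)
  qed
  have cell_small: "card (?cell x) \<le> k * k" if "x \<notin> ?W" "x \<notin> ?V" for x
  proof -
    obtain I J where x: "x = (I, J)" by (cases x)
    have a: "card (snd ` ?cell x) \<le> k"
      using that(1) by (simp add: x wide_blocks_def)
    have "snd ` ((P\<inverse>) \<inter> block s J \<times> block s I) = fst ` ?cell x"
      by (force simp: x)
    then have b: "card (fst ` ?cell x) \<le> k"
      using that(2) by (simp add: x wide_blocks_def)
    have "card (?cell x) \<le> card (fst ` ?cell x \<times> snd ` ?cell x)"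
      using finP by (intro card_mono) (force simp: x)+
    also have "\<dots> \<le> k * k" unfolding card_cartesian_product by (rule mult_le_mono[OF b a])
    finally show ?thesis .
  qed
  have "P \<subseteq> (\<Union>x\<in>?C. ?cell x)" by force
  then have "card P \<le> card (\<Union>x\<in>?C. ?cell x)"
    using CW finP by (intro card_mono) auto
  also have "\<dots> \<le> (\<Sum>x\<in>?C. card (?cell x))"
    using CW by (rule card_UN_le)
  also have "\<dots> \<le> (\<Sum>x\<in>?C. k * k + (s * s) * of_bool (x \<in> ?W) + (s * s) * of_bool (x \<in> ?V))"
  proof (rule sum_mono)
    fix x
    show "card (?cell x) \<le> k * k + (s * s) * of_bool (x \<in> ?W) + (s * s) * of_bool (x \<in> ?V)"
      using cell_le[of x] cell_small[of x] by (cases "x \<in> ?W"; cases "x \<in> ?V") simp_all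
  qed
  also have "\<dots> = card ?C * (k * k) + (s * s) * card (?C \<inter> ?W) + (s * s) * card (?C \<inter> ?V)"
    using CW by (simp add: sum.distrib sum_distrib_left[symmetric] sum_of_bool_eq)
  also have "\<dots> \<le> (D * s ^ t) * (k * k) + (s * s) * (s ^ t * d) + (s * s) * (s ^ t * d)"
  proof (intro add_mono mult_mono le_refl zero_le C)
    show "card (?C \<inter> ?W) \<le> s ^ t * d"
      using card_mono[OF W(1) Int_lower2] W(2) by (rule order_trans)
    show "card (?C \<inter> ?V) \<le> s ^ t * d"
      using card_mono[OF V(1) Int_lower2] V(2) by (rule order_trans)
  qed
  also have "\<dots> = (D * (k * k) + 2 * (s * s) * d) * s ^ t"
    by (simp add: algebra_simps)
  also have "\<dots> \<le> (D * s) * s ^ t"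
  proof (rule mult_right_mono)
    have "D * (k * k) + 2 * (s * s) * d \<le> D * (k * k) + D"
      by (simp add: D_def)
    also have "\<dots> \<le> D * s" unfolding s by (simp add: algebra_simps)
    finally show "D * (k * k) + 2 * (s * s) * d \<le> D * s" .
  qed simp
  finally have "card P \<le> D * (s * s ^ t)" by (simp only: mult.assoc)
  then show ?case unfolding D_def d_def power_Suc .
qed


lemma power_between:
  assumes "s \<ge> 2" "n \<ge> 1"
  obtains t where "n \<le> s ^ t" "s ^ t \<le> s * (n :: nat)"
proof -
  define t where "t = (LEAST t. n \<le> s ^ t)"
  have ex: "n \<le> s ^ n"
    using assms(1) less_exp[of n] power_mono[of 2 s n] by linarith
  then have le: "n \<le> s ^ t" unfolding t_def by (rule LeastI)
  have "s ^ t \<le> s * n"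
  proof (cases t)
    case 0
    then show ?thesis using assms by simp
  next
    case (Suc t')
    then have "t' < (LEAST t. n \<le> s ^ t)" by (simp add: t_def)
    then have "\<not> n \<le> s ^ t'" by (rule not_less_Least)
    then show ?thesis using Suc by simp
  qed
  with le that show ?thesis by blast
qed

text \<open>
  The extremal bound of Marcus and Tardos, in the form that excludes a grid: the side of an arbitrary
  square is rounded up to a power of the block side.
\<close>

theorem Marcus_Tardos_grid:
  "\<exists>C. \<forall>n P. P \<subseteq> {..<n} \<times> {..<n} \<longrightarrow> \<not> has_grid k P \<longrightarrow> card P \<le> C * n"
proof (intro exI allI impI)
  fix n P assume P: "P \<subseteq> {..<n} \<times> {..<n}" and ng: "\<not> has_grid k P"
  define s where "s = Suc (Suc k) * Suc (Suc k)"
  define C where "C = Suc (2 * (s * s) * (Suc (Suc k) * 2 ^ s))"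
  have ng': "\<not> has_grid (Suc (Suc k)) P" using ng has_grid_mono by (metis le_SucI order_refl)
  show "card P \<le> (C * s) * n"
  proof (cases "n = 0")
    case False
    then obtain t where t: "n \<le> s ^ t" "s ^ t \<le> s * n"
      using power_between[of s n] unfolding s_def by auto
    from P t(1) have "P \<subseteq> {..<s ^ t} \<times> {..<s ^ t}" by fastforce
    then have "card P \<le> C * s ^ t"
      unfolding C_def by (rule grid_free_power_bound[OF s_def _ ng'])
    also have "\<dots> \<le> C * (s * n)" using t(2) by (rule mult_le_mono2)
    finally show ?thesis by (simp add: mult.assoc)
  qed (use P in auto)
qed

definition grid_free_sets :: "nat \<Rightarrow> nat \<Rightarrow> (nat \<times> nat) set set" where
  "grid_free_sets k n = {P. P \<subseteq> {..<n} \<times> {..<n} \<and> \<not> has_grid k P}"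

lemma finite_grid_free_sets: "finite (grid_free_sets k n)"
  unfolding grid_free_sets_def by (rule finite_subset[of _ "Pow ({..<n} \<times> {..<n})"]) auto

lemma card_preimage_contract:
  assumes s: "s > 0" and fin: "finite Q"
  shows "finite {(i, j). (i div s, j div s) \<in> Q} \<and> card {(i, j). (i div s, j div s) \<in> Q} \<le> s * s * card Q"
proof -
  have eq: "{(i, j). (i div s, j div s) \<in> Q} = (\<Union>(I, J)\<in>Q. block s I \<times> block s J)"
    by auto
  have "card (\<Union>(I, J)\<in>Q. block s I \<times> block s J) \<le> (\<Sum>x\<in>Q. card (case x of (I, J) \<Rightarrow> block s I \<times> block s J))"
    by (rule card_UN_le[OF fin])
  also have "\<dots> = s * s * card Q"
    using s by (simp add: split_def card_cartesian_product card_block)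
  moreover have "finite (\<Union>(I, J)\<in>Q. block s I \<times> block s J)"
    using fin s by (auto simp: finite_block)
  ultimately show ?thesis unfolding eq by simp
qed

text \<open>
  Klazar's argument: a set without grid is contained in the preimage of its contraction by 2, which is
  again without grid and has linearly many points. So halving the side costs O(n) bits.
\<close>

theorem Klazar_count: "\<exists>C. \<forall>n. card (grid_free_sets k n) \<le> 2 ^ (C * n)"
proof -
  from Marcus_Tardos_grid obtain C where
    C: "\<And>n P. P \<subseteq> {..<n} \<times> {..<n} \<Longrightarrow> \<not> has_grid k P \<Longrightarrow> card P \<le> C * n" by blast
  have pow: "card (grid_free_sets k (2 ^ t)) \<le> 2 ^ (Suc (4 * C) * 2 ^ t)" for t
  proof (induction t)
    case 0
    have "grid_free_sets k (2 ^ 0) \<subseteq> Pow {(0, 0)}" unfolding grid_free_sets_def by auto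
    then have "card (grid_free_sets k (2 ^ 0)) \<le> card (Pow {(0::nat, 0::nat)})"
      by (intro card_mono) simp_all
    also have "\<dots> = 2 ^ 1" by (simp add: card_Pow)
    also have "\<dots> \<le> 2 ^ (Suc (4 * C) * 2 ^ 0)" by (intro power_increasing) simp_all
    finally show ?case .
  next
    case (Suc t)
    let ?blow = "\<lambda>Q. {(i, j). (i div 2, j div 2) \<in> Q}"
    have "grid_free_sets k (2 ^ Suc t) \<subseteq> (\<Union>Q\<in>grid_free_sets k (2 ^ t). Pow (?blow Q))"
    proof
      fix P assume P: "P \<in> grid_free_sets k (2 ^ Suc t)"
      then have "contract 2 P \<in> grid_free_sets k (2 ^ t)"
        using has_grid_contract[of k 2 P] unfolding grid_free_sets_def by auto
      moreover have "P \<in> Pow (?blow (contract 2 P))" by force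
      ultimately show "P \<in> (\<Union>Q\<in>grid_free_sets k (2 ^ t). Pow (?blow Q))" by blast
    qed
    moreover have blow: "finite (Pow (?blow Q)) \<and> card (Pow (?blow Q)) \<le> 2 ^ (4 * C * 2 ^ t)"
      if Q: "Q \<in> grid_free_sets k (2 ^ t)" for Q
    proof -
      have "finite Q" "card Q \<le> C * 2 ^ t"
        using Q C unfolding grid_free_sets_def by (auto intro: finite_subset)
      with card_preimage_contract[of 2 Q] have "finite (?blow Q)" "card (?blow Q) \<le> 4 * C * 2 ^ t"
        by auto
      then show ?thesis by (simp add: card_Pow)
    qed
    ultimately have "card (grid_free_sets k (2 ^ Suc t)) \<le> card (\<Union>Q\<in>grid_free_sets k (2 ^ t). Pow (?blow Q))"
      by (intro card_mono finite_UN_I finite_grid_free_sets) blast+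
    also have "\<dots> \<le> (\<Sum>Q\<in>grid_free_sets k (2 ^ t). card (Pow (?blow Q)))"
      by (rule card_UN_le[OF finite_grid_free_sets])
    also have "\<dots> \<le> (\<Sum>Q\<in>grid_free_sets k (2 ^ t). 2 ^ (4 * C * 2 ^ t))"
      using blow by (intro sum_mono) blast
    also have "\<dots> \<le> 2 ^ (Suc (4 * C) * 2 ^ t) * 2 ^ (4 * C * 2 ^ t)"
      using Suc.IH by simp
    also have "\<dots> = 2 ^ (Suc (4 * C) * 2 ^ t + 4 * C * 2 ^ t)" by (simp only: power_add)
    also have "\<dots> \<le> 2 ^ (Suc (4 * C) * 2 ^ Suc t)" by (intro power_increasing) simp_all
    finally show ?case .
  qed
  have "card (grid_free_sets k n) \<le> 2 ^ (2 * Suc (4 * C) * n)" for n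
  proof (cases "n = 0")
    case True
    then have "grid_free_sets k n \<subseteq> {{}}" unfolding grid_free_sets_def by auto
    then have "card (grid_free_sets k n) \<le> card {{} :: (nat \<times> nat) set}" by (intro card_mono) simp_all
    then show ?thesis using True by simp
  next
    case False
    then obtain t where t: "n \<le> 2 ^ t" "2 ^ t \<le> 2 * n"
      using power_between[of 2 n] by auto
    then have "grid_free_sets k n \<subseteq> grid_free_sets k (2 ^ t)"
      unfolding grid_free_sets_def by fastforce
    then have "card (grid_free_sets k n) \<le> card (grid_free_sets k (2 ^ t))"
      by (intro card_mono finite_grid_free_sets)
    also have "\<dots> \<le> 2 ^ (Suc (4 * C) * 2 ^ t)" by (rule pow)
    also have "\<dots> \<le> 2 ^ (2 * Suc (4 * C) * n)"
    proof (rule power_increasing)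
      have "Suc (4 * C) * 2 ^ t \<le> Suc (4 * C) * (2 * n)" using t(2) by (rule mult_le_mono2)
      then show "Suc (4 * C) * 2 ^ t \<le> 2 * Suc (4 * C) * n" by (simp only: mult_ac)
    qed simp
    finally show ?thesis .
  qed
  then show ?thesis by blast
qed

section \<open>Ramsey arguments for matrices and grids\<close>

text \<open>
  A column restricted to R is represented by the set of rows in R where it has a 1.
\<close>

definition col_types :: "(nat \<Rightarrow> nat \<Rightarrow> bool) \<Rightarrow> nat set \<Rightarrow> nat set \<Rightarrow> nat set set" where
  "col_types a R C = (\<lambda>j. {i \<in> R. a i j}) ` C"

text \<open>
  Distinct columns differ in some row; keep the half of the column types that has the more frequent
  value x in this row, and put aside one column with the other value. Each round loses at most half
  of the types, and yields a row that is constantly x on all later columns but not on its own column.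
\<close>

lemma col_types_halving:
  assumes "finite C" and "2 ^ h \<le> card (col_types a R C)"
  shows "\<exists>p q x. (\<forall>i<h. p i \<in> R \<and> q i \<in> C \<and> a (p i) (q i) \<noteq> x i) \<and>
    (\<forall>i j. i < j \<longrightarrow> j < h \<longrightarrow> a (p i) (q j) = x i)"
  using assms
proof (induction h arbitrary: C)
  case 0
  then show ?case by simp
next
  case (Suc h)
  have fin: "finite (col_types a R C)" using Suc.prems(1) by (simp add: col_types_def)
  have "\<not> card (col_types a R C) \<le> Suc 0"
  proof -
    have "2 * 1 \<le> 2 * (2 :: nat) ^ h" by (intro mult_le_mono2) simp
    then show ?thesis using Suc.prems(2) unfolding power_Suc by linarith
  qed
  then obtain S T where "S \<in> col_types a R C" "T \<in> col_types a R C" "S \<noteq> T"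
    using card_le_Suc0_iff_eq[OF fin] by blast
  then obtain j1 j2 where j: "j1 \<in> C" "j2 \<in> C" "{i \<in> R. a i j1} \<noteq> {i \<in> R. a i j2}"
    by (auto simp: col_types_def)
  then obtain r where r: "r \<in> R" "a r j1 \<noteq> a r j2" by blast
  define D where "D b = {j \<in> C. a r j = b}" for b
  have "col_types a R C = col_types a R (D True) \<union> col_types a R (D False)"
    by (auto simp: col_types_def D_def)
  then have "card (col_types a R C) \<le> card (col_types a R (D True)) + card (col_types a R (D False))"
    by (metis card_Un_le)
  then have "2 ^ h \<le> card (col_types a R (D True)) \<or> 2 ^ h \<le> card (col_types a R (D False))"
    using Suc.prems(2) by simp linarith
  then obtain b where b: "2 ^ h \<le> card (col_types a R (D b))" by blast
  have finD: "finite (D b)" using Suc.prems(1) by (simp add: D_def)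
  from Suc.IH[OF finD b] obtain p q x where
    IH: "\<And>i. i < h \<Longrightarrow> p i \<in> R \<and> q i \<in> D b \<and> a (p i) (q i) \<noteq> x i"
      "\<And>i j. i < j \<Longrightarrow> j < h \<Longrightarrow> a (p i) (q j) = x i" by blast
  obtain j0 where j0: "j0 \<in> C" "a r j0 \<noteq> b" using j r by metis
  define p' where "p' = case_nat r p"
  define q' where "q' = case_nat j0 q"
  define x' where "x' = case_nat b x"
  have "p' i \<in> R \<and> q' i \<in> C \<and> a (p' i) (q' i) \<noteq> x' i" if "i < Suc h" for i
    using that IH(1) r(1) j0 by (cases i) (auto simp: p'_def q'_def x'_def D_def)
  moreover have "a (p' i) (q' j) = x' i" if "i < j" "j < Suc h" for i j
  proof -
    obtain j' where "j = Suc j'" using \<open>i < j\<close> by (metis less_imp_Suc_add)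
    then show ?thesis using that IH by (cases i) (auto simp: p'_def q'_def x'_def D_def)
  qed
  ultimately show ?case by blast
qed

lemma ramsey_pairs:
  fixes w :: nat
  assumes "finite K"
  shows "\<exists>N. \<forall>f. (\<forall>u v. f u v \<in> K) \<longrightarrow>
    (\<exists>e c. (\<forall>i<w. e i < N) \<and> (\<forall>i j. i < j \<longrightarrow> j < w \<longrightarrow> e i < (e j :: nat) \<and> f (e i) (e j) = c))"
proof -
  obtain N :: nat where N: "partn_lst {..<N} (replicate (card K) w) 2"
    using ramsey_full by blast
  obtain h where h: "bij_betw h K {0..<card K}"
    using ex_bij_betw_finite_nat[OF assms] by blast
  have "\<exists>e c. (\<forall>i<w. e i < N) \<and> (\<forall>i j. i < j \<longrightarrow> j < w \<longrightarrow> e i < e j \<and> f (e i) (e j) = c)"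
    if f: "\<And>u v. f u v \<in> K" for f
  proof -
    define F where "F S = h (f (Min S) (Max S))" for S :: "nat set"
    have "F \<in> nsets {..<N} 2 \<rightarrow> {..<card K}"
      using f h by (auto simp: F_def bij_betw_def)
    from partn_lstE[OF N this] obtain i H where
      i: "i < card K" and H: "H \<in> nsets {..<N} w" and mono: "F ` nsets H 2 \<subseteq> {i}"
      by (metis length_replicate nth_replicate)
    then have H': "finite H" "H \<subseteq> {..<N}" "card H = w" by (auto simp: nsets_def)
    obtain e where e: "bij_betw e {..<card H} H" "strict_mono_on {..<card H} e"
      using ex_bij_betw_strict_mono_card[OF H'(1)] by blast
    have eH: "e k \<in> H" if "k < w" for k
      using that e(1) H'(3) by (auto simp: bij_betw_def)
    have "e k < e l \<and> f (e k) (e l) = inv_into K h i" if "k < l" "l < w" for k l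
    proof -
      have less: "e k < e l" using e(2) that H'(3) by (auto simp: strict_mono_on_def)
      then have "{e k, e l} \<in> nsets H 2"
        using eH that by (auto simp: nsets_def card_insert_if)
      then have "F {e k, e l} = i" using mono by blast
      moreover have "Min {e k, e l} = e k" "Max {e k, e l} = e l" using less by auto
      ultimately have "h (f (e k) (e l)) = i" by (simp add: F_def)
      then show ?thesis using less f h by (auto simp: bij_betw_def inv_into_f_f)
    qed
    then show ?thesis using eH H'(2) by blast
  qed
  then show ?thesis by blast
qed

text \<open>
  A pair of second coordinates is coloured by the whole colouring that it induces on pairs of
  first coordinates from a fixed finite range. On a homogeneous set for this colouring, the colour
  depends on the first coordinates alone, and Ramsey's theorem applies once more.
\<close>

lemma ramsey_product:
  fixes w :: nat
  assumes K: "finite K"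
  shows "\<exists>N. \<forall>f. (\<forall>u u' v v'. f u u' v v' \<in> K) \<longrightarrow>
    (\<exists>d e c. (\<forall>i<w. d i < N \<and> e i < N) \<and>
      (\<forall>i j. i < j \<longrightarrow> j < w \<longrightarrow> d i < (d j :: nat) \<and> e i < (e j :: nat)) \<and>
      (\<forall>i j k l. i < j \<longrightarrow> j < w \<longrightarrow> k < l \<longrightarrow> l < w \<longrightarrow> f (d i) (d j) (e k) (e l) = c))"
proof -
  obtain N1 where N1: "\<And>f. (\<And>u v. f u v \<in> K) \<Longrightarrow> \<exists>e c. (\<forall>i<w. e i < N1) \<and>
      (\<forall>i j. i < j \<longrightarrow> j < w \<longrightarrow> e i < (e j :: nat) \<and> f (e i) (e j) = c)"
    using ramsey_pairs[OF K, of w] by blast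
  define K2 where "K2 = Pow ({..<N1} \<times> {..<N1} \<times> K)"
  have K2: "finite K2" using K by (simp add: K2_def)
  obtain N2 where N2: "\<And>f. (\<And>u v. f u v \<in> K2) \<Longrightarrow> \<exists>e c. (\<forall>i<w. e i < N2) \<and>
      (\<forall>i j. i < j \<longrightarrow> j < w \<longrightarrow> e i < (e j :: nat) \<and> f (e i) (e j) = c)"
    using ramsey_pairs[OF K2, of w] by blast
  have "\<exists>d e c. (\<forall>i<w. d i < max N1 N2 \<and> e i < max N1 N2) \<and>
      (\<forall>i j. i < j \<longrightarrow> j < w \<longrightarrow> d i < (d j :: nat) \<and> e i < (e j :: nat)) \<and>
      (\<forall>i j k l. i < j \<longrightarrow> j < w \<longrightarrow> k < l \<longrightarrow> l < w \<longrightarrow> f (d i) (d j) (e k) (e l) = c)"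
    if f: "\<And>u u' v v'. f u u' v v' \<in> K" for f
  proof -
    define g where "g v v' = {(u, u', x). u < N1 \<and> u' < N1 \<and> x = f u u' v v'}" for v v'
    have "g v v' \<in> K2" for v v' using f by (auto simp: g_def K2_def)
    from N2[of g, OF this] obtain e G where e: "\<And>i. i < w \<Longrightarrow> e i < N2"
      "\<And>i j. i < j \<Longrightarrow> j < w \<Longrightarrow> e i < e j \<and> g (e i) (e j) = G" by blast
    define f' where "f' u u' = f u u' (e 0) (e 1)" for u u'
    have "f' u v \<in> K" for u v using f by (simp add: f'_def)
    from N1[of f', OF this] obtain d c where d: "\<And>i. i < w \<Longrightarrow> d i < N1"
      "\<And>i j. i < j \<Longrightarrow> j < w \<Longrightarrow> d i < d j \<and> f' (d i) (d j) = c" by blast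
    have "f (d i) (d j) (e k) (e l) = c" if "i < j" "j < w" "k < l" "l < w" for i j k l
    proof -
      have "g (e k) (e l) = G" "g (e 0) (e 1) = G" using e(2) that by auto
      moreover have "(d i, d j, f (d i) (d j) (e k) (e l)) \<in> g (e k) (e l)"
        using d(1) that by (auto simp: g_def)
      ultimately have "(d i, d j, f (d i) (d j) (e k) (e l)) \<in> g (e 0) (e 1)" by simp
      then have "f (d i) (d j) (e k) (e l) = f' (d i) (d j)" by (simp add: g_def f'_def)
      also have "\<dots> = c" using d(2) that by blast
      finally show ?thesis .
    qed
    moreover have "d i < d j \<and> e i < e j" if "i < j" "j < w" for i j using d(2) e(2) that by blast
    moreover have "d i < max N1 N2 \<and> e i < max N1 N2" if "i < w" for i :: nat
      using d(1)[OF that] e(1)[OF that] by (simp add: less_max_iff_disj)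
    ultimately show ?thesis by blast
  qed
  then show ?thesis by blast
qed

text \<open>
  The three unavoidable patterns, coded by 0, 1, 2: identity, co-identity and half graph. The order of
  the rows and columns that carry the pattern is irrelevant, so one half graph represents all four.
\<close>

definition canonical :: "nat \<Rightarrow> nat \<Rightarrow> nat \<Rightarrow> bool" where
  "canonical t i j \<longleftrightarrow> (if t = 0 then i = j else if t = 1 then i \<noteq> j else i \<le> j)"

text \<open>
  In the sequence obtained by halving, the entries above the diagonal of a row are constant and differ
  from the diagonal entry. Colouring pairs by this constant and by the entry below the diagonal makes
  all three kinds of entries uniform. If both sides of the diagonal agree, the pattern is an
  identity or a co-identity, otherwise a half graph, possibly after a shift or a reversal of labels.
\<close>

lemma many_col_types_canonical:
  "\<exists>k. \<forall>a R C. finite C \<longrightarrow> k \<le> card (col_types a R C) \<longrightarrow>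
    (\<exists>t p q. t < 3 \<and> (\<forall>i<w. p i \<in> R \<and> q i \<in> C) \<and>
      (\<forall>i<w. \<forall>j<w. a (p i) (q j) = canonical t i j))"
proof -
  \<comment> \<open>Two indices more than labels: one for the shift below, and one so that every index in use
    has a successor.\<close>
  obtain N where N: "\<And>f. (\<And>u v. f u v \<in> (UNIV :: (bool \<times> bool) set)) \<Longrightarrow>
      \<exists>e c. (\<forall>i<w + 2. e i < N) \<and>
      (\<forall>i j. i < j \<longrightarrow> j < w + 2 \<longrightarrow> e i < (e j :: nat) \<and> f (e i) (e j) = c)"
    using ramsey_pairs[of "UNIV :: (bool \<times> bool) set" "w + 2"] by auto
  have "\<exists>t p q. t < 3 \<and> (\<forall>i<w. p i \<in> R \<and> q i \<in> C) \<and>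
      (\<forall>i<w. \<forall>j<w. a (p i) (q j) = canonical t i j)"
    if "finite C" "2 ^ N \<le> card (col_types a R C)" for a R C
  proof -
    from col_types_halving[OF that] obtain p q x where
      pq: "\<And>i. i < N \<Longrightarrow> p i \<in> R \<and> q i \<in> C \<and> a (p i) (q i) \<noteq> x i"
        "\<And>i j. i < j \<Longrightarrow> j < N \<Longrightarrow> a (p i) (q j) = x i" by blast
    from N[of "\<lambda>i j. (x i, a (p j) (q i))", OF UNIV_I] obtain e c where
      ec: "(\<forall>i<w + 2. e i < N) \<and> (\<forall>i j. i < j \<longrightarrow> j < w + 2 \<longrightarrow>
        e i < e j \<and> (x (e i), a (p (e j)) (q (e i))) = c)" by (elim exE)
    then have e: "\<And>i. i < w + 2 \<Longrightarrow> e i < N" "\<And>i j. i < j \<Longrightarrow> j < w + 2 \<Longrightarrow> e i < e j"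
      and c: "\<And>i j. i < j \<Longrightarrow> j < w + 2 \<Longrightarrow> (x (e i), a (p (e j)) (q (e i))) = c"
      by (simp_all only:)
    obtain x0 y where "c = (x0, y)" by (cases c)
    with c have xe: "x (e i) = x0" if "i \<le> w" for i
      using that c[of i "Suc i"] by simp
    have low: "a (p (e j)) (q (e i)) = y" if "i < j" "j < w + 2" for i j
      using c[OF that] \<open>c = (x0, y)\<close> by simp
    have up: "a (p (e i)) (q (e j)) = x0" if "i < j" "j < w + 2" for i j
      using pq(2)[of "e i" "e j"] e that xe[of i] by simp
    have dia: "a (p (e i)) (q (e i)) = (\<not> x0)" if "i \<le> w" for i
      using pq(1)[of "e i"] e(1)[of i] xe[of i] that by auto
    have mem: "p (e i) \<in> R" "q (e i) \<in> C" if "i < w + 2" for i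
      using pq(1) e(1) that by blast+
    show ?thesis
    proof (cases "x0 = y")
      case True
      show ?thesis
      proof (intro exI conjI allI impI)
        show "(if x0 then 1 else 0) < (3 :: nat)" by simp
        fix i assume "i < w" then show "p (e i) \<in> R" "q (e i) \<in> C" using mem by simp_all
        fix j assume "j < w"
        with \<open>i < w\<close> show "a (p (e i)) (q (e j)) = canonical (if x0 then 1 else 0) i j"
          using low[of j i] up[of i j] dia[of i] True
          by (cases i j rule: linorder_cases) (auto simp: canonical_def)
      qed
    next
      case neq: False
      show ?thesis
      \<comment> \<open>A shift by one turns a strict order into a weak one; a
        reversal of all labels turns \<open>\<ge>\<close> into \<open>\<le>\<close>.\<close>
      proof (cases x0)
        case True
        show ?thesis
        proof (intro exI conjI allI impI)
          show "2 < (3 :: nat)" by simp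
          fix i assume i: "i < w" then show "p (e i) \<in> R" "q (e (Suc i)) \<in> C" using mem by simp_all
          fix j assume j: "j < w"
          show "a (p (e i)) (q (e (Suc j))) = canonical 2 i j"
            using i j low[of "Suc j" i] up[of i "Suc j"] dia[of i] True neq
            by (cases i "Suc j" rule: linorder_cases) (auto simp: canonical_def)
        qed
      next
        case False
        show ?thesis
        proof (intro exI conjI allI impI)
          show "2 < (3 :: nat)" by simp
          fix i assume i: "i < w" then show "p (e (w - i)) \<in> R" "q (e (w - i)) \<in> C" using mem by simp_all
          fix j assume j: "j < w"
          show "a (p (e (w - i))) (q (e (w - j))) = canonical 2 i j"
            using i j low[of "w - j" "w - i"] up[of "w - i" "w - j"] dia[of "w - i"] False neq
            by (cases i j rule: linorder_cases) (auto simp: canonical_def)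
        qed
      qed
    qed
  qed
  then show ?thesis by blast
qed

section \<open>Rich divisions contain one of the six families\<close>

text \<open>
  One kind s has to serve all permutations of a given size; only this uniformity allows one kind to be
  selected for all sizes later.
\<close>

definition realizes :: "(nat \<Rightarrow> nat \<Rightarrow> bool) \<Rightarrow> nat set \<Rightarrow> nat set \<Rightarrow> kind \<Rightarrow> nat \<Rightarrow> bool" where
  "realizes a R C s n \<longleftrightarrow> (\<forall>\<sigma>. \<sigma> permutes {0..<n} \<longrightarrow>
     (\<exists>f g. strict_mono_on {..<n} f \<and> strict_mono_on {..<n} g \<and> f ` {..<n} \<subseteq> R \<and> g ` {..<n} \<subseteq> C \<and>
       (\<forall>i<n. \<forall>j<n. a (f i) (g j) = entry_one s \<sigma> i j)))"

text \<open>
  Cell (u, v) of a W by W grid contributes rows P u v i and columns Q u v i, labelled by i. The entry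
  at a row and a column from cells in general position depends only on the relative position of
  the cells and on the labels, by means of b.

  The permutation is encoded in the choice of cells. If b depends on the comparison of v and v', place
  the cells of all rows on the same side of the cells of all columns in the u-direction, at a single
  u-coordinate for the columns; then the v-coordinate of the i-th row is at liberty to encode \<sigma> i,
  interleaved with the v-coordinates of the columns by means of even and odd numbers. If b depends on
  the comparison of u and u', exchange the roles of rows and columns and use the inverse permutation.
  If b depends on neither, the entries within a cell decide. Where they differ from b, choosing the
  i-th row from cell (i, \<sigma> i) and the j-th column from the cell with second coordinate j among these
  singles out the ones of the permutation matrix. If they never differ, the label \<sigma> i of the i-th row
  encodes the permutation.
\<close>

lemma homogeneous_grid_realizes:
  fixes P Q :: "nat \<Rightarrow> nat \<Rightarrow> nat \<Rightarrow> nat" and b :: "bool \<Rightarrow> bool \<Rightarrow> nat \<Rightarrow> nat \<Rightarrow> bool"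
  assumes W: "2 * n + 2 \<le> W"
    and mem: "\<And>u v i. u < W \<Longrightarrow> v < W \<Longrightarrow> i < n \<Longrightarrow> P u v i \<in> R \<and> Q u v i \<in> C"
    and incP: "\<And>u v i u' v' i'. u < u' \<Longrightarrow> u' < W \<Longrightarrow> v < W \<Longrightarrow> v' < W \<Longrightarrow> i < n \<Longrightarrow> i' < n \<Longrightarrow>
      P u v i < P u' v' i'"
    and incQ: "\<And>u v i u' v' i'. v < v' \<Longrightarrow> v' < W \<Longrightarrow> u < W \<Longrightarrow> u' < W \<Longrightarrow> i < n \<Longrightarrow> i' < n \<Longrightarrow>
      Q u v i < Q u' v' i'"
    and bg: "\<And>u v i u' v' j. u \<noteq> u' \<Longrightarrow> v \<noteq> v' \<Longrightarrow> u < W \<Longrightarrow> v < W \<Longrightarrow> u' < W \<Longrightarrow> v' < W \<Longrightarrow>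
      i < n \<Longrightarrow> j < n \<Longrightarrow> a (P u v i) (Q u' v' j) = b (u < u') (v < v') i j"
    and cell: "\<And>u v i j. u < W \<Longrightarrow> v < W \<Longrightarrow> i < n \<Longrightarrow> j < n \<Longrightarrow>
      a (P u v i) (Q u v j) = canonical t i j"
  shows "\<exists>s. realizes a R C s n"
proof -
  have ex6I: "\<exists>u v l u' v' l'. X u v l u' v' l'" if "X u v l u' v' l'"
    for X :: "(nat \<Rightarrow> nat) \<Rightarrow> (nat \<Rightarrow> nat) \<Rightarrow> (nat \<Rightarrow> nat) \<Rightarrow> (nat \<Rightarrow> nat) \<Rightarrow> (nat \<Rightarrow> nat) \<Rightarrow> (nat \<Rightarrow> nat) \<Rightarrow> bool"
      and u v l u' v' l'
    by (intro exI) (rule that)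
  have realizesI: "realizes a R C s n"
    if "\<And>\<sigma> \<tau>. \<sigma> permutes {0..<n} \<Longrightarrow> \<tau> = inv_into UNIV \<sigma> \<Longrightarrow>
      (\<And>i. i < n \<Longrightarrow> \<sigma> i < n \<and> \<tau> i < n \<and> \<sigma> (\<tau> i) = i \<and> \<tau> (\<sigma> i) = i) \<Longrightarrow>
      \<exists>u v l u' v' l'. (\<forall>i<n. u i < W \<and> v i < W \<and> l i < n \<and> u' i < W \<and> v' i < W \<and> l' i < n) \<and>
        strict_mono_on {..<n} u \<and> strict_mono_on {..<n} v' \<and>
        (\<forall>i<n. \<forall>j<n. a (P (u i) (v i) (l i)) (Q (u' j) (v' j) (l' j)) = entry_one s \<sigma> i j)"
    for s
    unfolding realizes_def
  proof (intro allI impI)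
    fix \<sigma> assume \<sigma>: "\<sigma> permutes {0..<n}"
    have "\<sigma> i < n \<and> inv_into UNIV \<sigma> i < n \<and> \<sigma> (inv_into UNIV \<sigma> i) = i \<and> inv_into UNIV \<sigma> (\<sigma> i) = i"
      if "i < n" for i
      using that permutes_in_image[OF \<sigma>, of i] permutes_in_image[OF permutes_inv[OF \<sigma>], of i]
        permutes_inverses[OF \<sigma>] by simp
    from that[OF \<sigma> refl this] obtain u v l u' v' l' where
      dom: "\<And>i. i < n \<Longrightarrow> u i < W \<and> v i < W \<and> l i < n \<and> u' i < W \<and> v' i < W \<and> l' i < n"
      and inc: "strict_mono_on {..<n} u" "strict_mono_on {..<n} v'"
      and ent: "\<And>i j. i < n \<Longrightarrow> j < n \<Longrightarrow>
        a (P (u i) (v i) (l i)) (Q (u' j) (v' j) (l' j)) = entry_one s \<sigma> i j" by blast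
    show "\<exists>f g. strict_mono_on {..<n} f \<and> strict_mono_on {..<n} g \<and> f ` {..<n} \<subseteq> R \<and>
        g ` {..<n} \<subseteq> C \<and> (\<forall>i<n. \<forall>j<n. a (f i) (g j) = entry_one s \<sigma> i j)"
    proof (rule exI[of _ "\<lambda>i. P (u i) (v i) (l i)"], rule exI[of _ "\<lambda>j. Q (u' j) (v' j) (l' j)"],
        intro conjI)
      show "strict_mono_on {..<n} (\<lambda>i. P (u i) (v i) (l i))"
        using inc(1) dom by (auto simp: strict_mono_on_def intro!: incP)
      show "strict_mono_on {..<n} (\<lambda>j. Q (u' j) (v' j) (l' j))"
        using inc(2) dom by (auto simp: strict_mono_on_def intro!: incQ)
      show "(\<lambda>i. P (u i) (v i) (l i)) ` {..<n} \<subseteq> R" "(\<lambda>j. Q (u' j) (v' j) (l' j)) ` {..<n} \<subseteq> C"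
        using mem dom by auto
    qed (use ent in blast)
  qed
  have W': "n < W" "\<And>i. i < n \<Longrightarrow> 2 * i + 1 < W" "\<And>i. i < n \<Longrightarrow> Suc i < W" "\<And>i. i < n \<Longrightarrow> i < W"
    "\<And>i. i < n \<Longrightarrow> 2 * i < W" "0 < W"
    using W by auto
  consider (vert) x i0 j0 where "i0 < n" "j0 < n" "b x True i0 j0 \<noteq> b x False i0 j0"
    | (horiz) y i0 j0 where "i0 < n" "j0 < n" "b True y i0 j0 \<noteq> b False y i0 j0"
    | (const) "\<And>x y i j. i < n \<Longrightarrow> j < n \<Longrightarrow> b x y i j = b True True i j"
    by (metis (full_types))
  then show ?thesis
  proof cases
    case vert
    \<comment> \<open>For true x, the cells of the rows precede those of the columns in the u-direction, else
      they follow.\<close>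
    define u where "u i = (if x then i else Suc i)" for i :: nat
    define u' where "u' = (if x then n else 0)"
    have u: "u i \<noteq> u'" "(u i < u') = x" "u i < W" "u' < W" if "i < n" for i
      using that W'(1,3,4,6) by (auto simp: u_def u'_def)
    have su: "strict_mono_on {..<n} u" by (auto simp: strict_mono_on_def u_def)
    show ?thesis
    proof (cases "b x True i0 j0")
      case True
      then have F: "\<not> b x False i0 j0" using vert by simp
      have "realizes a R C GeC n"
      proof (rule realizesI)
        fix \<sigma> \<tau> assume \<sigma>: "\<And>i. i < n \<Longrightarrow> \<sigma> i < n \<and> \<tau> i < n \<and> \<sigma> (\<tau> i) = i \<and> \<tau> (\<sigma> i) = i"
        have "a (P (u i) (2 * \<sigma> i) i0) (Q u' (2 * j + 1) j0) = entry_one GeC \<sigma> i j"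
          if "i < n" "j < n" for i j
        proof -
          have "2 * \<sigma> i \<noteq> 2 * j + 1" by presburger
          then have "a (P (u i) (2 * \<sigma> i) i0) (Q u' (2 * j + 1) j0) = b x (2 * \<sigma> i < 2 * j + 1) i0 j0"
            using bg[of "u i" u' "2 * \<sigma> i" "2 * j + 1" i0 j0] u[OF that(1)] W' \<sigma> that vert by simp
          then show ?thesis using True F by (cases "\<sigma> i \<le> j") auto
        qed
        then show "\<exists>u v l u' v' l'. (\<forall>i<n. u i < W \<and> v i < W \<and> l i < n \<and> u' i < W \<and> v' i < W \<and> l' i < n) \<and>
          strict_mono_on {..<n} u \<and> strict_mono_on {..<n} v' \<and>
          (\<forall>i<n. \<forall>j<n. a (P (u i) (v i) (l i)) (Q (u' j) (v' j) (l' j)) = entry_one GeC \<sigma> i j)"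
          using u su W' \<sigma> vert
          by (intro ex6I[of _ u "\<lambda>i. 2 * \<sigma> i" "\<lambda>_. i0" "\<lambda>_. u'" "\<lambda>j. 2 * j + 1" "\<lambda>_. j0"]) (auto simp: strict_mono_on_def)
      qed
      then show ?thesis by blast
    next
      case False
      then have F: "b x False i0 j0" using vert by simp
      have "realizes a R C LeC n"
      proof (rule realizesI)
        fix \<sigma> \<tau> assume \<sigma>: "\<And>i. i < n \<Longrightarrow> \<sigma> i < n \<and> \<tau> i < n \<and> \<sigma> (\<tau> i) = i \<and> \<tau> (\<sigma> i) = i"
        have "a (P (u i) (2 * \<sigma> i + 1) i0) (Q u' (2 * j) j0) = entry_one LeC \<sigma> i j"
          if "i < n" "j < n" for i j
        proof -
          have "2 * \<sigma> i + 1 \<noteq> 2 * j" by presburger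
          then have "a (P (u i) (2 * \<sigma> i + 1) i0) (Q u' (2 * j) j0) = b x (2 * \<sigma> i + 1 < 2 * j) i0 j0"
            using bg[of "u i" u' "2 * \<sigma> i + 1" "2 * j" i0 j0] u[OF that(1)] W' \<sigma> that vert by simp
          then show ?thesis using False F by (cases "j \<le> \<sigma> i") auto
        qed
        then show "\<exists>u v l u' v' l'. (\<forall>i<n. u i < W \<and> v i < W \<and> l i < n \<and> u' i < W \<and> v' i < W \<and> l' i < n) \<and>
          strict_mono_on {..<n} u \<and> strict_mono_on {..<n} v' \<and>
          (\<forall>i<n. \<forall>j<n. a (P (u i) (v i) (l i)) (Q (u' j) (v' j) (l' j)) = entry_one LeC \<sigma> i j)"
          using u su W' \<sigma> vert
          by (intro ex6I[of _ u "\<lambda>i. 2 * \<sigma> i + 1" "\<lambda>_. i0" "\<lambda>_. u'" "\<lambda>j. 2 * j" "\<lambda>_. j0"]) (auto simp: strict_mono_on_def)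
      qed
      then show ?thesis by blast
    qed
  next
    case horiz
    \<comment> \<open>For true y, the cells of the rows precede those of the columns in the v-direction, else
      they follow.\<close>
    define v where "v = (if y then 0 else n)"
    define v' where "v' j = (if y then Suc j else j)" for j :: nat
    have v: "v \<noteq> v' j" "(v < v' j) = y" "v < W" "v' j < W" if "j < n" for j
      using that W'(1,3,4,6) by (auto simp: v_def v'_def)
    have sv: "strict_mono_on {..<n} v'" by (auto simp: strict_mono_on_def v'_def)
    show ?thesis
    proof (cases "b True y i0 j0")
      case True
      then have F: "\<not> b False y i0 j0" using horiz by simp
      have "realizes a R C LeR n"
      proof (rule realizesI)
        fix \<sigma> \<tau> assume \<sigma>: "\<And>i. i < n \<Longrightarrow> \<sigma> i < n \<and> \<tau> i < n \<and> \<sigma> (\<tau> i) = i \<and> \<tau> (\<sigma> i) = i"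
          and \<tau>: "\<tau> = inv_into UNIV \<sigma>"
        have "a (P (2 * i) v i0) (Q (2 * \<tau> j + 1) (v' j) j0) = entry_one LeR \<sigma> i j"
          if "i < n" "j < n" for i j
        proof -
          have "2 * i \<noteq> 2 * \<tau> j + 1" by presburger
          then have "a (P (2 * i) v i0) (Q (2 * \<tau> j + 1) (v' j) j0) = b (2 * i < 2 * \<tau> j + 1) y i0 j0"
            using bg[of "2 * i" "2 * \<tau> j + 1" v "v' j" i0 j0] v[OF that(2)] W' \<sigma> that horiz by simp
          then show ?thesis using True F by (cases "i \<le> \<tau> j") (auto simp: \<tau>)
        qed
        then show "\<exists>u v l u' v' l'. (\<forall>i<n. u i < W \<and> v i < W \<and> l i < n \<and> u' i < W \<and> v' i < W \<and> l' i < n) \<and>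
          strict_mono_on {..<n} u \<and> strict_mono_on {..<n} v' \<and>
          (\<forall>i<n. \<forall>j<n. a (P (u i) (v i) (l i)) (Q (u' j) (v' j) (l' j)) = entry_one LeR \<sigma> i j)"
          using v sv W' \<sigma> horiz
          by (intro ex6I[of _ "\<lambda>i. 2 * i" "\<lambda>_. v" "\<lambda>_. i0" "\<lambda>j. 2 * \<tau> j + 1" v' "\<lambda>_. j0"]) (auto simp: strict_mono_on_def)
      qed
      then show ?thesis by blast
    next
      case False
      then have F: "b False y i0 j0" using horiz by simp
      have "realizes a R C GeR n"
      proof (rule realizesI)
        fix \<sigma> \<tau> assume \<sigma>: "\<And>i. i < n \<Longrightarrow> \<sigma> i < n \<and> \<tau> i < n \<and> \<sigma> (\<tau> i) = i \<and> \<tau> (\<sigma> i) = i"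
          and \<tau>: "\<tau> = inv_into UNIV \<sigma>"
        have "a (P (2 * i + 1) v i0) (Q (2 * \<tau> j) (v' j) j0) = entry_one GeR \<sigma> i j"
          if "i < n" "j < n" for i j
        proof -
          have "2 * i + 1 \<noteq> 2 * \<tau> j" by presburger
          then have "a (P (2 * i + 1) v i0) (Q (2 * \<tau> j) (v' j) j0) = b (2 * i + 1 < 2 * \<tau> j) y i0 j0"
            using bg[of "2 * i + 1" "2 * \<tau> j" v "v' j" i0 j0] v[OF that(2)] W' \<sigma> that horiz by simp
          then show ?thesis using False F by (cases "\<tau> j \<le> i") (auto simp: \<tau>)
        qed
        then show "\<exists>u v l u' v' l'. (\<forall>i<n. u i < W \<and> v i < W \<and> l i < n \<and> u' i < W \<and> v' i < W \<and> l' i < n) \<and>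
          strict_mono_on {..<n} u \<and> strict_mono_on {..<n} v' \<and>
          (\<forall>i<n. \<forall>j<n. a (P (u i) (v i) (l i)) (Q (u' j) (v' j) (l' j)) = entry_one GeR \<sigma> i j)"
          using v sv W' \<sigma> horiz
          by (intro ex6I[of _ "\<lambda>i. 2 * i + 1" "\<lambda>_. v" "\<lambda>_. i0" "\<lambda>j. 2 * \<tau> j" v' "\<lambda>_. j0"]) (auto simp: strict_mono_on_def)
      qed
      then show ?thesis by blast
    qed
  next
    case const
    define \<beta> where "\<beta> = b True True"
    have bg': "a (P u v i) (Q u' v' j) = \<beta> i j"
      if "u \<noteq> u'" "v \<noteq> v'" "u < W" "v < W" "u' < W" "v' < W" "i < n" "j < n" for u v i u' v' j
      using bg[OF that] const[OF that(7,8)] by (simp add: \<beta>_def)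
    show ?thesis
    proof (cases "\<exists>i0<n. \<exists>j0<n. \<beta> i0 j0 \<noteq> canonical t i0 j0")
      case True
      then obtain i0 j0 where ij: "i0 < n" "j0 < n" "\<beta> i0 j0 \<noteq> canonical t i0 j0" by blast
      define s where "s = (if \<beta> i0 j0 then Neq else Eq)"
      have "realizes a R C s n"
      proof (rule realizesI)
        fix \<sigma> \<tau> assume \<sigma>: "\<And>i. i < n \<Longrightarrow> \<sigma> i < n \<and> \<tau> i < n \<and> \<sigma> (\<tau> i) = i \<and> \<tau> (\<sigma> i) = i"
        have "a (P i (\<sigma> i) i0) (Q (\<tau> j) j j0) = entry_one s \<sigma> i j" if "i < n" "j < n" for i j
        proof (cases "\<sigma> i = j")
          case True
          then have "\<tau> j = i" using \<sigma> that by blast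
          then have "a (P i (\<sigma> i) i0) (Q (\<tau> j) j j0) = canonical t i0 j0"
            using True cell[of i j i0 j0] ij W' that by simp
          then show ?thesis using ij(3) True by (simp add: s_def)
        next
          case False
          then have "\<tau> j \<noteq> i" using \<sigma> that by blast
          then have "a (P i (\<sigma> i) i0) (Q (\<tau> j) j j0) = \<beta> i0 j0"
            using False ij that W'(4) \<sigma> by (intro bg') blast+
          then show ?thesis using False by (simp add: s_def)
        qed
        then show "\<exists>u v l u' v' l'. (\<forall>i<n. u i < W \<and> v i < W \<and> l i < n \<and> u' i < W \<and> v' i < W \<and> l' i < n) \<and>
          strict_mono_on {..<n} u \<and> strict_mono_on {..<n} v' \<and>
          (\<forall>i<n. \<forall>j<n. a (P (u i) (v i) (l i)) (Q (u' j) (v' j) (l' j)) = entry_one s \<sigma> i j)"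
          using W'(4) \<sigma> ij
          by (intro ex6I[of _ "\<lambda>i. i" \<sigma> "\<lambda>_. i0" \<tau> "\<lambda>j. j" "\<lambda>_. j0"]) (auto simp: strict_mono_on_def)
      qed
      then show ?thesis by blast
    next
      case False
      define s where "s = (if t = 0 then Eq else if t = 1 then Neq else GeC)"
      have "realizes a R C s n"
      proof (rule realizesI)
        fix \<sigma> \<tau> assume \<sigma>: "\<And>i. i < n \<Longrightarrow> \<sigma> i < n \<and> \<tau> i < n \<and> \<sigma> (\<tau> i) = i \<and> \<tau> (\<sigma> i) = i"
        have "a (P i n (\<sigma> i)) (Q n j j) = entry_one s \<sigma> i j" if "i < n" "j < n" for i j
        proof -
          have "a (P i n (\<sigma> i)) (Q n j j) = \<beta> (\<sigma> i) j"
            using W'(1,4) that \<sigma> by (intro bg') (blast | force)+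
          also have "\<dots> = canonical t (\<sigma> i) j" using False \<sigma> that by blast
          finally show ?thesis by (auto simp: canonical_def s_def)
        qed
        then show "\<exists>u v l u' v' l'. (\<forall>i<n. u i < W \<and> v i < W \<and> l i < n \<and> u' i < W \<and> v' i < W \<and> l' i < n) \<and>
          strict_mono_on {..<n} u \<and> strict_mono_on {..<n} v' \<and>
          (\<forall>i<n. \<forall>j<n. a (P (u i) (v i) (l i)) (Q (u' j) (v' j) (l' j)) = entry_one s \<sigma> i j)"
          using W' \<sigma>
          by (intro ex6I[of _ "\<lambda>i. i" "\<lambda>_. n" \<sigma> "\<lambda>_. n" "\<lambda>j. j" "\<lambda>j. j"]) (auto simp: strict_mono_on_def)
      qed
      then show ?thesis by blast
    qed
  qed
qed

text \<open>
  The parts of the division are clipped to the n1 rows and n2 columns of the matrix, since the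
  sequences are not bounded.
\<close>

definition rich_division :: "nat \<Rightarrow> nat \<Rightarrow> nat \<Rightarrow> (nat \<Rightarrow> nat \<Rightarrow> bool) \<Rightarrow> bool" where
  "rich_division k n1 n2 a \<longleftrightarrow> (\<exists>r c. mono r \<and> mono c \<and> (\<forall>x<k. \<forall>y<k.
     k \<le> card (col_types a ({r x..<r (Suc x)} \<inter> {..<n1}) ({c y..<c (Suc y)} \<inter> {..<n2}))))"

text \<open>
  Each cell of the division contains a canonical pattern. A pair of cells u < u', v < v' of the grid
  is coloured by the entries between the patterns at opposite corners of this square and by the kind
  of pattern in its first cell. A homogeneous subgrid satisfies the assumptions of
  \<open>homogeneous_grid_realizes\<close>.
\<close>

theorem rich_division_realizes:
  "\<exists>k. \<forall>a n1 n2. rich_division k n1 n2 a \<longrightarrow> (\<exists>s. realizes a {..<n1} {..<n2} s n)"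
proof -
  define W where "W = 2 * n + 2"
  define K where "K = ({..<6} \<times> {..<n + 3} \<times> {..<n + 1} :: (nat \<times> nat \<times> nat) set)"
  obtain k1 where k1: "\<And>a R C. finite C \<Longrightarrow> k1 \<le> card (col_types a R C) \<Longrightarrow>
    \<exists>t p q. t < 3 \<and> (\<forall>i<n. p i \<in> R \<and> q i \<in> C) \<and> (\<forall>i<n. \<forall>j<n. a (p i) (q j) = canonical t i j)"
    using many_col_types_canonical[of n] by blast
  have "finite (Pow K)" by (simp add: K_def)
  \<comment> \<open>One index more than W, so that every cell in use is the first one of some square.\<close>
  from ramsey_product[OF this, of "Suc W"] obtain N where N:
    "\<And>f. (\<And>u u' v v'. f u u' v v' \<in> Pow K) \<Longrightarrow>
      \<exists>d e c. (\<forall>i<Suc W. d i < N \<and> e i < N) \<and>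
      (\<forall>i j. i < j \<longrightarrow> j < Suc W \<longrightarrow> d i < (d j :: nat) \<and> e i < (e j :: nat)) \<and>
      (\<forall>i j k l. i < j \<longrightarrow> j < Suc W \<longrightarrow> k < l \<longrightarrow> l < Suc W \<longrightarrow> f (d i) (d j) (e k) (e l) = c)"
    by (elim exE) metis
  have "\<exists>s. realizes a {..<n1} {..<n2} s n" if "rich_division (max k1 N) n1 n2 a" for a n1 n2
  proof -
    from that obtain r c where rc: "mono r" "mono c" and
      rich: "\<And>x y. x < max k1 N \<Longrightarrow> y < max k1 N \<Longrightarrow> max k1 N \<le>
        card (col_types a ({r x..<r (Suc x)} \<inter> {..<n1}) ({c y..<c (Suc y)} \<inter> {..<n2}))"
      unfolding rich_division_def by (elim exE conjE) simp
    have "\<forall>u v. \<exists>t p q. u < N \<longrightarrow> v < N \<longrightarrow> t < 3 \<and>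
      (\<forall>i<n. p i \<in> {r u..<r (Suc u)} \<inter> {..<n1} \<and> q i \<in> {c v..<c (Suc v)} \<inter> {..<n2}) \<and>
      (\<forall>i<n. \<forall>j<n. a (p i) (q j) = canonical t i j)"
    proof (intro allI)
      fix u v
      show "\<exists>t p q. u < N \<longrightarrow> v < N \<longrightarrow> t < 3 \<and>
        (\<forall>i<n. p i \<in> {r u..<r (Suc u)} \<inter> {..<n1} \<and> q i \<in> {c v..<c (Suc v)} \<inter> {..<n2}) \<and>
        (\<forall>i<n. \<forall>j<n. a (p i) (q j) = canonical t i j)"
      proof (cases "u < N \<and> v < N")
        case True
        then have "k1 \<le> card (col_types a ({r u..<r (Suc u)} \<inter> {..<n1}) ({c v..<c (Suc v)} \<inter> {..<n2}))"
          using rich[of u v] by linarith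
        with k1[of "{c v..<c (Suc v)} \<inter> {..<n2}" a "{r u..<r (Suc u)} \<inter> {..<n1}"]
        show ?thesis by blast
      qed blast
    qed
    then obtain t p q where cells: "\<And>u v. u < N \<Longrightarrow> v < N \<Longrightarrow> t u v < (3 :: nat) \<and>
      (\<forall>i<n. p u v i \<in> {r u..<r (Suc u)} \<inter> {..<n1} \<and> q u v i \<in> {c v..<c (Suc v)} \<inter> {..<n2}) \<and>
      (\<forall>i<n. \<forall>j<n. a (p u v i) (q u v j) = canonical (t u v) i j)"
      by metis
    \<comment> \<open>A colour is a set of triples: the first components 1 to 4 name the corner of the square
      that the row comes from, the column being taken from the opposite corner, and 5 marks the kind
      of the pattern in the first cell.\<close>
    define f where "f u u' v v' = K \<inter> {(m, i, j).
       (m = 1 \<and> a (p u v i) (q u' v' j)) \<or> (m = 2 \<and> a (p u v' i) (q u' v j)) \<or>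
       (m = 3 \<and> a (p u' v i) (q u v' j)) \<or> (m = 4 \<and> a (p u' v' i) (q u v j)) \<or>
       (m = 5 \<and> i = t u v \<and> j = 0)}" for u u' v v'
    have "f u u' v v' \<in> Pow K" for u u' v v' by (auto simp: f_def)
    from N[of f, OF this] obtain d e col where
      dec: "(\<forall>i<Suc W. d i < N \<and> e i < N) \<and>
        (\<forall>i j. i < j \<longrightarrow> j < Suc W \<longrightarrow> d i < d j \<and> e i < e j) \<and>
        (\<forall>i j k l. i < j \<longrightarrow> j < Suc W \<longrightarrow> k < l \<longrightarrow> l < Suc W \<longrightarrow> f (d i) (d j) (e k) (e l) = col)"
      by (elim exE)
    then have de: "\<And>i. i < Suc W \<Longrightarrow> d i < N \<and> e i < N"
      and inc: "\<And>i j. i < j \<Longrightarrow> j < Suc W \<Longrightarrow> d i < d j \<and> e i < e j"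
      and col: "\<And>i j k l. i < j \<Longrightarrow> j < Suc W \<Longrightarrow> k < l \<Longrightarrow> l < Suc W \<Longrightarrow> f (d i) (d j) (e k) (e l) = col"
      by (simp_all only:)
    define P where "P u v = p (d u) (e v)" for u v
    define Q where "Q u v = q (d u) (e v)" for u v
    define b where "b x y i j \<longleftrightarrow> ((if x then if y then 1 else 2 else if y then 3 else 4), i, j) \<in> col"
      for x y i j
    have tcol: "(5, i, 0) \<in> col \<longleftrightarrow> i = t (d u) (e v)" if "u < W" "v < W" "i < 3" for u v i
      using col[of u "Suc u" v "Suc v"] that by (auto simp: f_def K_def)
    show ?thesis
    proof (rule homogeneous_grid_realizes[where P = P and Q = Q and b = b and t = "t (d 0) (e 0)" and W = W])
      show "2 * n + 2 \<le> W" by (simp add: W_def)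
    next
      fix u v i assume "u < W" "v < W" "i < n"
      then show "P u v i \<in> {..<n1} \<and> Q u v i \<in> {..<n2}"
        using cells[of "d u" "e v"] de by (auto simp: P_def Q_def)
    next
      fix u v i u' v' i' assume uv: "u < u'" "u' < W" "v < W" "v' < W" "i < n" "i' < n"
      have "P u v i < r (Suc (d u))" "r (d u') \<le> P u' v' i'"
        using uv cells[of "d u" "e v"] cells[of "d u'" "e v'"] de by (auto simp: P_def)
      moreover have "r (Suc (d u)) \<le> r (d u')" using inc[of u u'] uv by (intro monoD[OF rc(1)]) simp
      ultimately show "P u v i < P u' v' i'" by simp
    next
      fix u v i u' v' i' assume uv: "v < v'" "v' < W" "u < W" "u' < W" "i < n" "i' < n"
      have "Q u v i < c (Suc (e v))" "c (e v') \<le> Q u' v' i'"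
        using uv cells[of "d u" "e v"] cells[of "d u'" "e v'"] de by (auto simp: Q_def)
      moreover have "c (Suc (e v)) \<le> c (e v')" using inc[of v v'] uv by (intro monoD[OF rc(2)]) simp
      ultimately show "Q u v i < Q u' v' i'" by simp
    next
      fix u v i u' v' j
      assume uv: "u \<noteq> u'" "v \<noteq> v'" "u < W" "v < W" "u' < W" "v' < W" "i < n" "j < n"
      have K: "m < 6 \<Longrightarrow> (m, i, j) \<in> K" for m using uv by (auto simp: K_def)
      show "a (P u v i) (Q u' v' j) = b (u < u') (v < v') i j"
      proof (cases "u < u'"; cases "v < v'")
        assume h: "u < u'" "v < v'"
        with uv have "col = f (d u) (d u') (e v) (e v')" using col by simp
        with h show ?thesis using K by (simp add: b_def f_def P_def Q_def)
      next
        assume h: "u < u'" "\<not> v < v'"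
        with uv have "col = f (d u) (d u') (e v') (e v)" using col by simp
        with h show ?thesis using K by (simp add: b_def f_def P_def Q_def)
      next
        assume h: "\<not> u < u'" "v < v'"
        with uv have "col = f (d u') (d u) (e v) (e v')" using col by simp
        with h show ?thesis using K by (simp add: b_def f_def P_def Q_def)
      next
        assume h: "\<not> u < u'" "\<not> v < v'"
        with uv have "col = f (d u') (d u) (e v') (e v)" using col by simp
        with h show ?thesis using K by (simp add: b_def f_def P_def Q_def)
      qed
    next
      fix u v i j assume uv: "u < W" "v < W" "i < n" "j < n"
      have "0 < W" using uv by simp
      have "t (d 0) (e 0) < 3" using cells de \<open>0 < W\<close> by simp
      then have "t (d 0) (e 0) = t (d u) (e v)" using tcol[of 0 0] tcol[of u v] \<open>0 < W\<close> uv by blast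
      then show "a (P u v i) (Q u v j) = canonical (t (d 0) (e 0)) i j"
        using cells[of "d u" "e v"] de uv by (simp add: P_def Q_def)
    qed
  qed
  then show ?thesis by blast
qed

section \<open>Redundant rows in matrices without a rich division\<close>

lemma card_col_types_mono:
  assumes "R \<subseteq> R'" "C \<subseteq> C'" "finite C'"
  shows "card (col_types a R C) \<le> card (col_types a R' C')"
proof -
  have "col_types a R C \<subseteq> (\<lambda>S. S \<inter> R) ` col_types a R' C'"
  proof
    fix S assume "S \<in> col_types a R C"
    then obtain j where "j \<in> C" "S = {i \<in> R. a i j}" by (auto simp: col_types_def)
    then have "{i \<in> R'. a i j} \<in> col_types a R' C'" "S = {i \<in> R'. a i j} \<inter> R"
      using assms(1,2) by (auto simp: col_types_def)
    then show "S \<in> (\<lambda>S. S \<inter> R) ` col_types a R' C'" by blast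
  qed
  then have "card (col_types a R C) \<le> card ((\<lambda>S. S \<inter> R) ` col_types a R' C')"
    using assms(3) by (intro card_mono) (simp_all add: col_types_def)
  also have "\<dots> \<le> card (col_types a R' C')"
    using assms(3) by (intro card_image_le) (simp add: col_types_def)
  finally show ?thesis .
qed

text \<open>
  The last column of blocks may be incomplete, hence the intersection.
\<close>

definition cell_types :: "nat \<Rightarrow> nat \<Rightarrow> (nat \<Rightarrow> nat \<Rightarrow> bool) \<Rightarrow> nat \<Rightarrow> nat \<Rightarrow> nat set set" where
  "cell_types L n2 a I J = col_types a (block L I) (block L J \<inter> {..<n2})"

definition rich_cells :: "nat \<Rightarrow> nat \<Rightarrow> nat \<Rightarrow> nat \<Rightarrow> (nat \<Rightarrow> nat \<Rightarrow> bool) \<Rightarrow> (nat \<times> nat) set" where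
  "rich_cells k L n1 n2 a =
     {(I, J). I < n1 div L \<and> J \<le> n2 div L \<and> k \<le> card (cell_types L n2 a I J)}"

text \<open>
  Freshness ignores the rich cells on the left. If it did not, columns of non-rich cells could repeat
  columns of rich cells, and the number of column types outside the rich cells would not be bounded
  by the number of fresh cells.
\<close>

definition fresh_cells :: "nat \<Rightarrow> nat \<Rightarrow> nat \<Rightarrow> nat \<Rightarrow> (nat \<Rightarrow> nat \<Rightarrow> bool) \<Rightarrow> (nat \<times> nat) set" where
  "fresh_cells k L n1 n2 a = {(I, J). I < n1 div L \<and> J \<le> n2 div L \<and> (I, J) \<notin> rich_cells k L n1 n2 a \<and>
     (\<exists>S\<in>cell_types L n2 a I J. \<forall>J'<J. (I, J') \<notin> rich_cells k L n1 n2 a \<longrightarrow> S \<notin> cell_types L n2 a I J')}"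

lemma block_subset:
  assumes "L > 0" "x \<le> I" "I < y"
  shows "block L I \<subseteq> {x * L..<y * L}"
  using assms by (auto simp: less_eq_div_iff_mult_less_eq[symmetric] div_less_iff_less_mult[symmetric])

lemma block_subset_lessThan:
  assumes "L > 0" "I < n div L"
  shows "block L I \<subseteq> {..<n}"
proof
  fix i assume "i \<in> block L I"
  with assms(2) have "i div L < n div L" by simp
  then show "i \<in> {..<n}" by (metis div_le_mono lessThan_iff linorder_not_less)
qed

text \<open>
  The number of column types only grows when a cell is enlarged.
\<close>

lemma rich_cells_grid:
  assumes L: "L > 0" and g: "has_grid k (rich_cells k L n1 n2 a)"
  shows "rich_division k n1 n2 a"
proof -
  from g obtain r c where rc: "mono r" "mono c" and
    pt: "\<And>x y. x < k \<Longrightarrow> y < k \<Longrightarrow> \<exists>I J. (I, J) \<in> rich_cells k L n1 n2 a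
      \<and> r x \<le> I \<and> I < r (Suc x) \<and> c y \<le> J \<and> J < c (Suc y)"
    by (rule has_gridE) blast
  have "k \<le> card (col_types a ({r x * L..<r (Suc x) * L} \<inter> {..<n1}) ({c y * L..<c (Suc y) * L} \<inter> {..<n2}))"
    if xy: "x < k" "y < k" for x y
  proof -
    from pt[OF xy] obtain I J where IJ: "(I, J) \<in> rich_cells k L n1 n2 a"
      "r x \<le> I" "I < r (Suc x)" "c y \<le> J" "J < c (Suc y)" by blast
    have I: "I < n1 div L" "k \<le> card (col_types a (block L I) (block L J \<inter> {..<n2}))"
      using IJ(1) by (auto simp: rich_cells_def cell_types_def)
    note I(2)
    also have "card (col_types a (block L I) (block L J \<inter> {..<n2})) \<le>
        card (col_types a ({r x * L..<r (Suc x) * L} \<inter> {..<n1}) ({c y * L..<c (Suc y) * L} \<inter> {..<n2}))"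
      using block_subset[OF L IJ(2,3)] block_subset[OF L IJ(4,5)] block_subset_lessThan[OF L I(1)]
      by (intro card_col_types_mono) auto
    finally show ?thesis .
  qed
  moreover have "mono (\<lambda>x. r x * L)" "mono (\<lambda>x. c x * L)" using rc by (auto simp: mono_def)
  ultimately show ?thesis unfolding rich_division_def by blast
qed

text \<open>
  Merge the columns of the division in groups of k. A merged cell that contains a rich cell is rich.
  Otherwise choose a fresh cell in each of its k column parts, and in it a new column: its restriction
  to the row of blocks of this fresh cell differs from all columns further left in the merged cell,
  because none of those lies in a rich cell. So the k chosen columns are distinct.
\<close>

lemma fresh_cells_grid:
  assumes L: "L > 0" and g: "has_grid (k * k) (fresh_cells k L n1 n2 a)"
  shows "rich_division k n1 n2 a"
proof -
  from g obtain r c where rc: "mono r" "mono c" and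
    pt: "\<And>x y. x < k * k \<Longrightarrow> y < k * k \<Longrightarrow> \<exists>I J. (I, J) \<in> fresh_cells k L n1 n2 a
      \<and> r x \<le> I \<and> I < r (Suc x) \<and> c y \<le> J \<and> J < c (Suc y)"
    by (rule has_gridE) blast
  have "k \<le> card (col_types a ({r x * L..<r (Suc x) * L} \<inter> {..<n1})
      ({c (k * y) * L..<c (k * Suc y) * L} \<inter> {..<n2}))" (is "k \<le> card (col_types a ?R ?C)")
    if xy: "x < k" "y < k" for x y
  proof (cases "\<exists>I J. (I, J) \<in> rich_cells k L n1 n2 a \<and> r x \<le> I \<and> I < r (Suc x) \<and>
      c (k * y) \<le> J \<and> J < c (k * Suc y)")
    case True
    then obtain I J where IJ: "(I, J) \<in> rich_cells k L n1 n2 a"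
      "r x \<le> I" "I < r (Suc x)" "c (k * y) \<le> J" "J < c (k * Suc y)" by blast
    have I: "I < n1 div L" "k \<le> card (col_types a (block L I) (block L J \<inter> {..<n2}))"
      using IJ(1) by (auto simp: rich_cells_def cell_types_def)
    note I(2)
    also have "card (col_types a (block L I) (block L J \<inter> {..<n2})) \<le> card (col_types a ?R ?C)"
      using block_subset[OF L IJ(2,3)] block_subset[OF L IJ(4,5)] block_subset_lessThan[OF L I(1)]
      by (intro card_col_types_mono) auto
    finally show ?thesis .
  next
    case False
    define good where "good z I J j \<longleftrightarrow> (I, J) \<in> fresh_cells k L n1 n2 a \<and>
      r x \<le> I \<and> I < r (Suc x) \<and>
      c (k * y + z) \<le> J \<and> J < c (Suc (k * y + z)) \<and> j \<in> block L J \<inter> {..<n2} \<and>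
      (\<forall>J'<J. (I, J') \<notin> rich_cells k L n1 n2 a \<longrightarrow>
        {i \<in> block L I. a i j} \<notin> cell_types L n2 a I J')" for z I J j
    have "\<forall>z. \<exists>I J j. z < k \<longrightarrow> good z I J j"
    proof
      fix z
      show "\<exists>I J j. z < k \<longrightarrow> good z I J j"
      proof (cases "z < k")
        case True
        have "k * y + z < k * Suc y" using True by simp
        also have "\<dots> \<le> k * k" using xy(2) by (intro mult_le_mono2) simp
        finally have z: "k * y + z < k * k" .
        have x: "x < k * k" using xy(1) by (metis less_le_trans le_square)
        from pt[OF x z] obtain I J where IJ: "(I, J) \<in> fresh_cells k L n1 n2 a"
          "r x \<le> I" "I < r (Suc x)" "c (k * y + z) \<le> J" "J < c (Suc (k * y + z))" by blast
        from IJ(1) obtain S where S: "S \<in> cell_types L n2 a I J"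
          "\<forall>J'<J. (I, J') \<notin> rich_cells k L n1 n2 a \<longrightarrow> S \<notin> cell_types L n2 a I J'"
          by (auto simp: fresh_cells_def)
        then obtain j where j: "j \<in> block L J \<inter> {..<n2}" "S = {i \<in> block L I. a i j}"
          by (auto simp: cell_types_def col_types_def)
        have "good z I J j"
          unfolding good_def by (intro conjI IJ j(1) S(2)[unfolded j(2)])
        then show ?thesis by blast
      next
        case False
        then show ?thesis by simp
      qed
    qed
    then obtain I J j where good: "\<And>z. z < k \<Longrightarrow> good z (I z) (J z) (j z)" by metis
    then have z: "\<And>z. z < k \<Longrightarrow> (I z, J z) \<in> fresh_cells k L n1 n2 a \<and>
      r x \<le> I z \<and> I z < r (Suc x) \<and>
      c (k * y + z) \<le> J z \<and> J z < c (Suc (k * y + z)) \<and> j z \<in> block L (J z) \<inter> {..<n2} \<and>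
      (\<forall>J'<J z. (I z, J') \<notin> rich_cells k L n1 n2 a \<longrightarrow>
        {i \<in> block L (I z). a i (j z)} \<notin> cell_types L n2 a (I z) J')"
      unfolding good_def .
    have Jbd: "c (k * y) \<le> J z \<and> J z < c (k * Suc y)" if "z < k" for z
    proof -
      have "c (k * y) \<le> c (k * y + z)" by (rule monoD[OF rc(2)]) simp
      moreover have "c (Suc (k * y + z)) \<le> c (k * Suc y)" using that by (intro monoD[OF rc(2)]) simp
      ultimately show ?thesis using z[OF that] by linarith
    qed
    have IR: "block L (I z) \<subseteq> ?R" if "z < k" for z
    proof -
      have "I z < n1 div L" using z[OF that] by (auto simp: fresh_cells_def)
      then show ?thesis using block_subset[OF L, of "r x" "I z" "r (Suc x)"]
          block_subset_lessThan[OF L] z[OF that] by blast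
    qed
    have jC: "j z \<in> ?C" if "z < k" for z
      using block_subset[OF L, of "c (k * y)" "J z" "c (k * Suc y)"] Jbd[OF that] z[OF that] by blast
    have neq: "{i \<in> ?R. a i (j z)} \<noteq> {i \<in> ?R. a i (j z')}" if zz: "z < z'" "z' < k" for z z'
    proof
      assume eq: "{i \<in> ?R. a i (j z)} = {i \<in> ?R. a i (j z')}"
      have zk: "z < k" using zz by simp
      have "{i \<in> block L (I z'). a i (j z)} = {i \<in> block L (I z'). a i (j z')}"
        using eq IR[OF zz(2)] by blast
      moreover have "{i \<in> block L (I z'). a i (j z)} \<in> cell_types L n2 a (I z') (J z)"
        using z[OF zk] by (auto simp: cell_types_def col_types_def)
      moreover have "J z < J z'"
      proof -
        have "c (Suc (k * y + z)) \<le> c (k * y + z')" using zz by (intro monoD[OF rc(2)]) simp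
        then show ?thesis using z[OF zk] z[OF zz(2)] by linarith
      qed
      moreover have "(I z', J z) \<notin> rich_cells k L n1 n2 a"
        using False Jbd[OF zk] z[OF zz(2)] by blast
      ultimately show False using z[OF zz(2)] by metis
    qed
    then have "inj_on (\<lambda>z. {i \<in> ?R. a i (j z)}) {..<k}"
      by (intro linorder_inj_onI) (auto simp del: Int_iff)
    then have "k = card ((\<lambda>z. {i \<in> ?R. a i (j z)}) ` {..<k})" by (simp add: card_image)
    also have "\<dots> \<le> card (col_types a ?R ?C)"
      using jC by (intro card_mono) (auto simp: col_types_def simp del: Int_iff)
    finally show ?thesis .
  qed
  moreover have "mono (\<lambda>x. r x * L)" "mono (\<lambda>y. c (k * y) * L)"
    using rc by (auto simp: mono_def)
  ultimately show ?thesis unfolding rich_division_def by blast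
qed

text \<open>
  A column type outside the rich cells occurs for the first time in a fresh cell, and a fresh cell has
  less than k types. So at most b k sets of rows describe everything outside the rich cells, and
  two rows that belong to the same ones of these sets agree there.
\<close>

lemma rows_agree_off_rich_cells:
  assumes L: "2 ^ (b * k) < L" and I: "I < n1 div L"
    and few: "card {J. (I, J) \<in> fresh_cells k L n1 n2 a} \<le> b"
  shows "\<exists>x\<in>block L I. \<exists>y\<in>block L I. x \<noteq> y \<and>
    (\<forall>j<n2. (I, j div L) \<notin> rich_cells k L n1 n2 a \<longrightarrow> a x j = a y j)"
proof -
  define F where "F = {J. (I, J) \<in> fresh_cells k L n1 n2 a}"
  define T where "T = (\<Union>J\<in>F. cell_types L n2 a I J)"
  have L0: "L > 0" using L by simp
  have finF: "finite F" unfolding F_def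
    by (rule finite_subset[of _ "{..n2 div L}"]) (auto simp: fresh_cells_def)
  have finT: "finite T" using finF by (auto simp: T_def cell_types_def col_types_def)
  have "card T \<le> (\<Sum>J\<in>F. card (cell_types L n2 a I J))"
    unfolding T_def by (rule card_UN_le[OF finF])
  also have "\<dots> \<le> (\<Sum>J\<in>F. k)"
    by (rule sum_mono) (auto simp: F_def fresh_cells_def rich_cells_def)
  also have "\<dots> \<le> b * k" using few by (simp add: F_def)
  finally have "card T \<le> b * k" .
  then have "2 ^ card T \<le> (2 :: nat) ^ (b * k)" by (intro power_increasing) simp_all
  also note L
  finally have "card (Pow T) < card (block L I)"
    using L0 finT by (simp add: card_Pow card_block)
  moreover have "(\<lambda>x. {S \<in> T. x \<in> S}) ` block L I \<subseteq> Pow T" by auto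
  ultimately have "\<not> inj_on (\<lambda>x. {S \<in> T. x \<in> S}) (block L I)"
    using finT by (metis card_inj_on_le finite_Pow_iff not_le)
  then obtain x y where xy: "x \<in> block L I" "y \<in> block L I" "x \<noteq> y"
    "{S \<in> T. x \<in> S} = {S \<in> T. y \<in> S}"
    by (auto simp: inj_on_def)
  have "a x j = a y j" if j: "j < n2" "(I, j div L) \<notin> rich_cells k L n1 n2 a" for j
  proof -
    define S where "S = {i \<in> block L I. a i j}"
    let ?ok = "\<lambda>J. (I, J) \<notin> rich_cells k L n1 n2 a \<and> S \<in> cell_types L n2 a I J"
    define J where "J = (LEAST J. ?ok J)"
    have ok: "?ok (j div L)" using j by (auto simp: S_def cell_types_def col_types_def)
    then have J: "?ok J" "J \<le> j div L" unfolding J_def by (rule LeastI, rule Least_le)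
    have least: "\<not> ?ok J'" if "J' < J" for J'
      using not_less_Least[of J' ?ok] that unfolding J_def by blast
    have "J \<le> n2 div L" using J(2) div_le_mono[of j n2 L] j by linarith
    then have "J \<in> F" using J(1) least I by (auto simp: F_def fresh_cells_def)
    then have "S \<in> T" using J(1) by (auto simp: T_def)
    then have "x \<in> S \<longleftrightarrow> y \<in> S" using xy(4) by blast
    then show ?thesis using xy(1,2) by (simp add: S_def)
  qed
  then show ?thesis using xy by blast
qed

text \<open>
  Averaging: as there are linearly many fresh cells, at least half of the rows of blocks contain at
  most b of them, for a b that does not depend on the side L of the blocks; thus L can be chosen
  large in terms of b. The pairs (x, y) in Q say that row x may be deleted and restored from row y.
\<close>

theorem deletable_rows:
  "\<exists>L>1. \<forall>a n1 n2. n2 \<le> n1 \<longrightarrow> L \<le> n1 \<longrightarrow> \<not> rich_division k n1 n2 a \<longrightarrow>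
    (\<exists>Q Rich. Q \<subseteq> {(x, y). x < n1 \<and> y < n1 \<and> x div L = y div L} \<and>
      card (fst ` Q) = (n1 div L + 1) div 2 \<and> fst ` Q \<inter> snd ` Q = {} \<and>
      Rich \<in> grid_free_sets k (Suc (n1 div L)) \<and>
      (\<forall>(x, y)\<in>Q. \<forall>j<n2. (x div L, j div L) \<notin> Rich \<longrightarrow> a x j = a y j))"
proof -
  from Marcus_Tardos_grid[of "k * k"] obtain C where
    C: "\<And>n P. P \<subseteq> {..<n} \<times> {..<n} \<Longrightarrow> \<not> has_grid (k * k) P \<Longrightarrow> card P \<le> C * n" by blast
  \<comment> \<open>There are at most 2 C N fresh cells in N rows of blocks, so at most half of
    these rows have more than 4 C.\<close>
  define b where "b = 4 * C"
  define L where "L = Suc (2 ^ (b * k))"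
  have L: "L > 1" "L > 0" "2 ^ (b * k) < L" by (simp_all add: L_def)
  show ?thesis
  proof (rule exI[of _ L], rule conjI[OF L(1)], intro allI impI)
    fix a n1 n2 assume n: "n2 \<le> n1" "L \<le> n1" and nr: "\<not> rich_division k n1 n2 a"
    define N where "N = n1 div L"
    define Rich where "Rich = rich_cells k L n1 n2 a"
    define Fresh where "Fresh = fresh_cells k L n1 n2 a"
    have N1: "N \<ge> 1" using n(2) L(2) by (simp add: N_def less_eq_div_iff_mult_less_eq)
    have n2: "n2 div L \<le> N" using n(1) by (simp add: N_def div_le_mono)
    have Rich: "Rich \<in> grid_free_sets k (Suc N)"
      using rich_cells_grid[OF L(2)] nr n2
      by (fastforce simp: grid_free_sets_def Rich_def rich_cells_def N_def[symmetric])
    have FreshN: "Fresh \<subseteq> {..<Suc N} \<times> {..<Suc N}"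
      using n2 by (auto simp: Fresh_def fresh_cells_def N_def[symmetric])
    have finFresh: "finite Fresh" by (rule finite_subset[OF FreshN]) simp
    have "card Fresh \<le> C * Suc N"
      by (rule C[OF FreshN]) (use fresh_cells_grid[OF L(2)] nr in \<open>auto simp: Fresh_def\<close>)
    also have "\<dots> \<le> C * (2 * N)" using N1 by (intro mult_le_mono2) simp
    finally have cF: "card Fresh \<le> C * (2 * N)" .
    let ?row = "\<lambda>I. {J. (I, J) \<in> Fresh}"
    have finRow: "finite (?row I)" for I
      by (rule finite_subset[of _ "snd ` Fresh"]) (use finFresh in force)+
    define G where "G = {I. I < N \<and> card (?row I) \<le> b}"
    define B where "B = {I. I < N \<and> \<not> card (?row I) \<le> b}"
    have fin: "finite G" "finite B" by (simp_all add: G_def B_def)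
    have "card B * Suc b \<le> (\<Sum>I\<in>B. card (?row I))"
      using sum_mono[of B "\<lambda>_. Suc b" "\<lambda>I. card (?row I)"] by (simp add: B_def)
    also have "\<dots> = card (SIGMA I:B. ?row I)"
      using fin finRow by (intro card_SigmaI[symmetric]) auto
    also have "\<dots> \<le> card Fresh" by (intro card_mono finFresh) auto
    finally have "card B * Suc (4 * C) \<le> C * (2 * N)" using cF by (simp add: b_def)
    then have "2 * card B \<le> N"
    proof (cases "C = 0")
      case False
      assume "card B * Suc (4 * C) \<le> C * (2 * N)"
      moreover have "C * (2 * (2 * card B)) \<le> card B * Suc (4 * C)" by simp
      ultimately have "C * (2 * (2 * card B)) \<le> C * (2 * N)" by linarith
      then show ?thesis using False unfolding mult_le_cancel1 by simp
    qed simp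
    moreover have "card G + card B = N"
    proof -
      have "G \<union> B = {..<N}" "G \<inter> B = {}" by (auto simp: G_def B_def)
      then show ?thesis using card_Un_disjoint[OF fin] by simp
    qed
    ultimately have "(N + 1) div 2 \<le> card G" by linarith
    then obtain G' where G': "G' \<subseteq> G" "card G' = (N + 1) div 2"
      using obtain_subset_with_card_n by metis
    have "\<forall>I\<in>G'. \<exists>x y. x \<in> block L I \<and> y \<in> block L I \<and> x \<noteq> y \<and>
      (\<forall>j<n2. (I, j div L) \<notin> Rich \<longrightarrow> a x j = a y j)"
    proof
      fix I assume "I \<in> G'"
      then have "I < n1 div L" "card {J. (I, J) \<in> fresh_cells k L n1 n2 a} \<le> b"
        using G'(1) by (auto simp: G_def N_def Fresh_def)
      from rows_agree_off_rich_cells[OF L(3) this]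
      show "\<exists>x y. x \<in> block L I \<and> y \<in> block L I \<and> x \<noteq> y \<and>
        (\<forall>j<n2. (I, j div L) \<notin> Rich \<longrightarrow> a x j = a y j)"
        unfolding Rich_def by blast
    qed
    then obtain x y where xy: "\<And>I. I \<in> G' \<Longrightarrow> x I div L = I \<and> y I div L = I \<and> x I \<noteq> y I \<and>
      (\<forall>j<n2. (I, j div L) \<notin> Rich \<longrightarrow> a (x I) j = a (y I) j)"
      unfolding mem_block by metis
    have bd: "x I < n1 \<and> y I < n1" if "I \<in> G'" for I
    proof -
      have "I < n1 div L" using that G'(1) by (auto simp: G_def N_def)
      then have "block L I \<subseteq> {..<n1}" by (rule block_subset_lessThan[OF L(2)])
      moreover have "x I \<in> block L I" "y I \<in> block L I" using xy[OF that] by simp_all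
      ultimately show ?thesis by blast
    qed
    define Q where "Q = (\<lambda>I. (x I, y I)) ` G'"
    show "\<exists>Q Rich. Q \<subseteq> {(x, y). x < n1 \<and> y < n1 \<and> x div L = y div L} \<and>
      card (fst ` Q) = (n1 div L + 1) div 2 \<and> fst ` Q \<inter> snd ` Q = {} \<and>
      Rich \<in> grid_free_sets k (Suc (n1 div L)) \<and>
      (\<forall>(x, y)\<in>Q. \<forall>j<n2. (x div L, j div L) \<notin> Rich \<longrightarrow> a x j = a y j)"
    proof (intro exI conjI)
      show "Q \<subseteq> {(x, y). x < n1 \<and> y < n1 \<and> x div L = y div L}"
        using bd xy by (auto simp: Q_def)
      have "inj_on x G'" using xy by (metis inj_onI)
      then show "card (fst ` Q) = (n1 div L + 1) div 2"
        using G'(2) by (simp add: Q_def image_image card_image N_def)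
      show "fst ` Q \<inter> snd ` Q = {}"
      proof (rule ccontr)
        assume "fst ` Q \<inter> snd ` Q \<noteq> {}"
        then obtain I I' where "I \<in> G'" "I' \<in> G'" "x I = y I'" by (auto simp: Q_def)
        then show False using xy by metis
      qed
      show "Rich \<in> grid_free_sets k (Suc (n1 div L))" using Rich by (simp add: N_def)
      show "\<forall>(x, y)\<in>Q. \<forall>j<n2. (x div L, j div L) \<notin> Rich \<longrightarrow> a x j = a y j"
        using xy by (auto simp: Q_def)
    qed
  qed
qed

section \<open>Ordered submatrices and classes of matrices\<close>

text \<open>
  Submatrices described by the order embeddings of their rows and columns rather than by sets of
  indices; in this form they can be composed and transposed.
\<close>

definition ordered_submatrix :: "'a mat \<Rightarrow> 'a mat \<Rightarrow> bool" where
  "ordered_submatrix B A \<longleftrightarrow> (\<exists>f g. strict_mono_on {..<dim_row B} f \<and> strict_mono_on {..<dim_col B} g \<and>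
     f ` {..<dim_row B} \<subseteq> {..<dim_row A} \<and> g ` {..<dim_col B} \<subseteq> {..<dim_col A} \<and>
     (\<forall>i<dim_row B. \<forall>j<dim_col B. B $$ (i, j) = A $$ (f i, g j)))"

lemma pick_image:
  assumes "strict_mono_on {..<m} f" "i < (m :: nat)"
  shows "pick (f ` {..<m}) i = f i"
proof -
  have less: "f x < f i \<longleftrightarrow> x < i" if "x < m" for x
    using assms that by (auto simp: strict_mono_on_def) (metis linorder_neqE_nat order_less_asym)
  then have "{a \<in> f ` {..<m}. a < f i} = f ` {..<i}"
    using assms(2) by auto
  moreover have "card (f ` {..<i}) = i"
    using inj_on_subset[OF strict_mono_on_imp_inj_on[OF assms(1)], of "{..<i}"] assms(2)
    by (subst card_image) auto
  ultimately show ?thesis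
    using pick_card_in_set[of "f i" "f ` {..<m}"] assms(2) by simp
qed

lemma submatrix_iff_ordered_submatrix:
  "(\<exists>I J. B = submatrix A I J) \<longleftrightarrow> ordered_submatrix B A"
proof
  assume "\<exists>I J. B = submatrix A I J"
  then obtain I J where B: "B = submatrix A I J" by blast
  have pick: "strict_mono_on {..<card {i. i < n \<and> i \<in> K}} (pick K) \<and>
      pick K ` {..<card {i. i < n \<and> i \<in> K}} \<subseteq> {..<n}" for n K
  proof (intro conjI)
    have "x < card K \<or> infinite K" if "x < card {i. i < n \<and> i \<in> K}" for x
    proof (cases "finite K")
      case True
      then have "card {i. i < n \<and> i \<in> K} \<le> card K" by (intro card_mono) auto
      with that show ?thesis by simp
    qed simp
    then show "strict_mono_on {..<card {i. i < n \<and> i \<in> K}} (pick K)"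
      by (auto simp: strict_mono_on_def intro: pick_mono)
    show "pick K ` {..<card {i. i < n \<and> i \<in> K}} \<subseteq> {..<n}"
      using pick_le by auto
  qed
  show "ordered_submatrix B A"
    unfolding ordered_submatrix_def B dim_submatrix
    by (rule exI[of _ "pick I"], rule exI[of _ "pick J"]) (use pick in \<open>simp add: submatrix_index\<close>)
next
  assume "ordered_submatrix B A"
  then obtain f g where fg: "strict_mono_on {..<dim_row B} f" "strict_mono_on {..<dim_col B} g"
      "f ` {..<dim_row B} \<subseteq> {..<dim_row A}" "g ` {..<dim_col B} \<subseteq> {..<dim_col A}"
      "\<And>i j. i < dim_row B \<Longrightarrow> j < dim_col B \<Longrightarrow> B $$ (i, j) = A $$ (f i, g j)"
    unfolding ordered_submatrix_def by (elim exE conjE) simp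
  let ?S = "submatrix A (f ` {..<dim_row B}) (g ` {..<dim_col B})"
  have "{i. i < dim_row A \<and> i \<in> f ` {..<dim_row B}} = f ` {..<dim_row B}"
    "{i. i < dim_col A \<and> i \<in> g ` {..<dim_col B}} = g ` {..<dim_col B}" using fg(3,4) by auto
  then have dim: "dim_row ?S = dim_row B" "dim_col ?S = dim_col B"
    using fg(1,2)[THEN strict_mono_on_imp_inj_on] by (simp_all add: dim_submatrix card_image)
  have "B = ?S"
  proof (rule eq_matI)
    fix i j assume "i < dim_row ?S" "j < dim_col ?S"
    moreover from this have "?S $$ (i, j) = A $$ (pick (f ` {..<dim_row B}) i, pick (g ` {..<dim_col B}) j)"
      by (intro submatrix_index) (simp_all add: dim_submatrix)
    ultimately show "B $$ (i, j) = ?S $$ (i, j)"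
      using dim pick_image[OF fg(1)] pick_image[OF fg(2)] fg(5) by simp
  qed (simp_all add: dim)
  then show "\<exists>I J. B = submatrix A I J" by blast
qed

lemma ordered_submatrix_refl: "ordered_submatrix A A"
  unfolding ordered_submatrix_def
  by (rule exI[of _ "\<lambda>i. i"], rule exI[of _ "\<lambda>i. i"]) (auto simp: strict_mono_on_def)

lemma ordered_submatrix_trans:
  assumes "ordered_submatrix C B" "ordered_submatrix B A"
  shows "ordered_submatrix C A"
proof -
  obtain f g where fg: "strict_mono_on {..<dim_row C} f" "strict_mono_on {..<dim_col C} g"
      "f ` {..<dim_row C} \<subseteq> {..<dim_row B}" "g ` {..<dim_col C} \<subseteq> {..<dim_col B}"
      "\<And>i j. i < dim_row C \<Longrightarrow> j < dim_col C \<Longrightarrow> C $$ (i, j) = B $$ (f i, g j)"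
    using assms(1) unfolding ordered_submatrix_def by (elim exE conjE) simp
  obtain f' g' where fg': "strict_mono_on {..<dim_row B} f'" "strict_mono_on {..<dim_col B} g'"
      "f' ` {..<dim_row B} \<subseteq> {..<dim_row A}" "g' ` {..<dim_col B} \<subseteq> {..<dim_col A}"
      "\<And>i j. i < dim_row B \<Longrightarrow> j < dim_col B \<Longrightarrow> B $$ (i, j) = A $$ (f' i, g' j)"
    using assms(2) unfolding ordered_submatrix_def by (elim exE conjE) simp
  have bd: "f i < dim_row B" if "i < dim_row C" for i using fg(3) that by auto
  have bd': "g i < dim_col B" if "i < dim_col C" for i using fg(4) that by auto
  show ?thesis
    unfolding ordered_submatrix_def
  proof (rule exI[of _ "\<lambda>i. f' (f i)"], rule exI[of _ "\<lambda>i. g' (g i)"], intro conjI)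
    show "strict_mono_on {..<dim_row C} (\<lambda>i. f' (f i))" "strict_mono_on {..<dim_col C} (\<lambda>i. g' (g i))"
      using fg(1,2) fg'(1,2) bd bd' by (simp_all add: strict_mono_on_def)
    show "(\<lambda>i. f' (f i)) ` {..<dim_row C} \<subseteq> {..<dim_row A}"
      "(\<lambda>i. g' (g i)) ` {..<dim_col C} \<subseteq> {..<dim_col A}"
      using fg'(3,4) bd bd' by (auto simp: image_subset_iff)
  qed (use fg(5) fg'(5) bd bd' in simp)
qed

lemma ordered_submatrix_transpose:
  assumes "ordered_submatrix B A"
  shows "ordered_submatrix (transpose_mat B) (transpose_mat A)"
proof -
  obtain f g where fg: "strict_mono_on {..<dim_row B} f" "strict_mono_on {..<dim_col B} g"
      "f ` {..<dim_row B} \<subseteq> {..<dim_row A}" "g ` {..<dim_col B} \<subseteq> {..<dim_col A}"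
      "\<And>i j. i < dim_row B \<Longrightarrow> j < dim_col B \<Longrightarrow> B $$ (i, j) = A $$ (f i, g j)"
    using assms unfolding ordered_submatrix_def by (elim exE conjE) simp
  have "f i < dim_row A" if "i < dim_row B" for i using fg(3) that by auto
  moreover have "g i < dim_col A" if "i < dim_col B" for i using fg(4) that by auto
  ultimately show ?thesis
    unfolding ordered_submatrix_def using fg
    by (intro exI[of _ g] exI[of _ f]) simp
qed

lemma ordered_submatrixI:
  assumes "strict_mono_on {..<m1} f" "strict_mono_on {..<m2} g"
    and "f ` {..<m1} \<subseteq> {..<dim_row A}" "g ` {..<m2} \<subseteq> {..<dim_col A}"
  shows "ordered_submatrix (mat m1 m2 (\<lambda>(i, j). A $$ (f i, g j))) A"
  unfolding ordered_submatrix_def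
  by (rule exI[of _ f], rule exI[of _ g]) (use assms in simp)

lemma matrix_class_iff: "matrix_class M \<longleftrightarrow> (\<forall>A\<in>M. \<forall>B. ordered_submatrix B A \<longrightarrow> B \<in> M)"
  unfolding matrix_class_def submatrix_iff_ordered_submatrix[symmetric] by blast

lemma perm_class_iff:
  "B \<in> perm_class s \<longleftrightarrow> (\<exists>n \<sigma>. n \<ge> 1 \<and> \<sigma> permutes {0..<n} \<and> ordered_submatrix B (perm_mat s n \<sigma>))"
  unfolding perm_class_def submatrix_iff_ordered_submatrix[symmetric] by blast

lemma matrix_class_perm_class: "matrix_class (perm_class s)"
  unfolding matrix_class_iff Ball_def perm_class_iff using ordered_submatrix_trans by blast

lemma matrix_class_transpose: "matrix_class M \<Longrightarrow> matrix_class (transpose_mat ` M)"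
  unfolding matrix_class_iff
proof (intro ballI allI impI)
  fix A B assume M: "\<forall>A\<in>M. \<forall>B. ordered_submatrix B A \<longrightarrow> B \<in> M"
    and A: "A \<in> transpose_mat ` M" and B: "ordered_submatrix B A"
  from A obtain A' where "A' \<in> M" "A = transpose_mat A'" by blast
  with ordered_submatrix_transpose[OF B] M have "transpose_mat B \<in> M" by simp
  then show "B \<in> transpose_mat ` M" by (metis imageI transpose_transpose)
qed

lemma perm_mat_dim [simp]: "dim_row (perm_mat s n \<sigma>) = n" "dim_col (perm_mat s n \<sigma>) = n"
  by (simp_all add: perm_mat_def)

lemma perm_mat_index [simp]:
  "i < n \<Longrightarrow> j < n \<Longrightarrow> perm_mat s n \<sigma> $$ (i, j) = (if entry_one s \<sigma> i j then 1 else 0)"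
  by (simp add: perm_mat_def)

fun transpose_kind :: "kind \<Rightarrow> kind" where
  "transpose_kind Eq = Eq"
| "transpose_kind Neq = Neq"
| "transpose_kind LeR = LeC"
| "transpose_kind GeR = GeC"
| "transpose_kind LeC = LeR"
| "transpose_kind GeC = GeR"

lemma transpose_perm_mat:
  assumes "\<sigma> permutes {0..<n}"
  shows "transpose_mat (perm_mat s n \<sigma>) = perm_mat (transpose_kind s) n (inv_into UNIV \<sigma>)"
proof -
  have bij: "bij \<sigma>" using assms by (rule permutes_bij)
  have "inv_into UNIV (inv_into UNIV \<sigma>) = \<sigma>" by (rule inv_inv_eq[OF bij])
  moreover have "\<sigma> j = i \<longleftrightarrow> inv_into UNIV \<sigma> i = j" for i j
    using bij by (metis bij_inv_eq_iff)
  ultimately have "entry_one s \<sigma> j i \<longleftrightarrow> entry_one (transpose_kind s) (inv_into UNIV \<sigma>) i j" for i j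
    by (cases s) auto
  then show ?thesis by (intro eq_matI) auto
qed

lemma transpose_perm_class:
  assumes "perm_class s \<subseteq> transpose_mat ` M"
  shows "perm_class (transpose_kind s) \<subseteq> M"
proof
  fix B assume "B \<in> perm_class (transpose_kind s)"
  then obtain n \<sigma> where n: "n \<ge> 1" and \<sigma>: "\<sigma> permutes {0..<n}"
    and B: "ordered_submatrix B (perm_mat (transpose_kind s) n \<sigma>)"
    unfolding perm_class_iff by blast
  have "transpose_kind (transpose_kind s) = s" by (cases s) simp_all
  then have "transpose_mat (perm_mat (transpose_kind s) n \<sigma>) = perm_mat s n (inv_into UNIV \<sigma>)"
    using transpose_perm_mat[OF \<sigma>, of "transpose_kind s"] by simp
  then have "ordered_submatrix (transpose_mat B) (perm_mat s n (inv_into UNIV \<sigma>))"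
    using ordered_submatrix_transpose[OF B] by simp
  then have "transpose_mat B \<in> perm_class s"
    unfolding perm_class_iff using n permutes_inv[OF \<sigma>] by blast
  then show "B \<in> M" using assms by auto
qed

definition ones :: "nat mat \<Rightarrow> nat \<Rightarrow> nat \<Rightarrow> bool" where
  "ones A i j \<longleftrightarrow> A $$ (i, j) = 1"

lemma zero_one_index:
  assumes "zero_one_mat A" "i < dim_row A" "j < dim_col A"
  shows "A $$ (i, j) = (if ones A i j then 1 else 0)"
proof -
  have "A $$ (i, j) \<in> elements_mat A" using assms(2,3) by (rule elements_matI[OF carrier_matI[OF refl refl] _ _ refl])
  then have "A $$ (i, j) \<in> {0, 1}" using assms(1) unfolding zero_one_mat_def by blast
  then show ?thesis by (auto simp: ones_def)
qed

text \<open>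
  For every size n, some kind s occurs for all permutations of size n. One kind occurs for
  infinitely many n, and extending a permutation by fixed points makes its matrix a submatrix of a
  larger one of the same kind.
\<close>

theorem rich_class_contains_perm_class:
  assumes M: "matrix_class M" "\<forall>A\<in>M. zero_one_mat A"
    and rich: "\<forall>k. \<exists>A\<in>M. rich_division k (dim_row A) (dim_col A) (ones A)"
  shows "\<exists>s. perm_class s \<subseteq> M"
proof -
  have "\<exists>s. \<forall>\<sigma>. \<sigma> permutes {0..<n} \<longrightarrow> perm_mat s n \<sigma> \<in> M" for n
  proof -
    obtain k where k: "\<And>a n1 n2. rich_division k n1 n2 a \<Longrightarrow> \<exists>s. realizes a {..<n1} {..<n2} s n"
      using rich_division_realizes[of n] by blast
    obtain A where A: "A \<in> M" "rich_division k (dim_row A) (dim_col A) (ones A)"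
      using rich by blast
    from k[OF A(2)] obtain s where s: "realizes (ones A) {..<dim_row A} {..<dim_col A} s n" by blast
    have "perm_mat s n \<sigma> \<in> M" if "\<sigma> permutes {0..<n}" for \<sigma>
    proof -
      from s[unfolded realizes_def, THEN spec, THEN mp, OF that] obtain f g where fg: "strict_mono_on {..<n} f" "strict_mono_on {..<n} g"
        "f ` {..<n} \<subseteq> {..<dim_row A}" "g ` {..<n} \<subseteq> {..<dim_col A}"
        "\<And>i j. i < n \<Longrightarrow> j < n \<Longrightarrow> ones A (f i) (g j) = entry_one s \<sigma> i j"
        by (elim exE conjE) simp
      have "perm_mat s n \<sigma> = mat n n (\<lambda>(i, j). A $$ (f i, g j))"
      proof (rule eq_matI)
        fix i j assume "i < dim_row (mat n n (\<lambda>(i, j). A $$ (f i, g j)))"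
          "j < dim_col (mat n n (\<lambda>(i, j). A $$ (f i, g j)))"
        then have ij: "i < n" "j < n" by simp_all
        then have "f i < dim_row A" "g j < dim_col A" using fg(3,4) by auto
        then have "A $$ (f i, g j) = (if ones A (f i) (g j) then 1 else 0)"
          using M(2) A(1) by (intro zero_one_index) auto
        then show "perm_mat s n \<sigma> $$ (i, j) = mat n n (\<lambda>(i, j). A $$ (f i, g j)) $$ (i, j)"
          using ij fg(5) by simp
      qed simp_all
      then have "ordered_submatrix (perm_mat s n \<sigma>) A" using ordered_submatrixI[OF fg(1-4)] by simp
      then show ?thesis using M(1) A(1) unfolding matrix_class_iff by blast
    qed
    then show ?thesis by blast
  qed
  then obtain s where s: "\<And>n \<sigma>. \<sigma> permutes {0..<n} \<Longrightarrow> perm_mat (s n) n \<sigma> \<in> M" by metis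
  have "finite (UNIV :: kind set)"
  proof -
    have "(UNIV :: kind set) \<subseteq> {Eq, Neq, LeR, GeR, LeC, GeC}" using kind.exhaust by auto
    then show ?thesis by (rule finite_subset) simp
  qed
  then obtain n0 where inf: "infinite {n. s n = s n0}"
    using pigeonhole_infinite[of "UNIV :: nat set" s] by (auto intro: finite_subset[OF subset_UNIV])
  have "perm_class (s n0) \<subseteq> M"
  proof
    fix B assume "B \<in> perm_class (s n0)"
    then obtain n \<sigma> where \<sigma>: "\<sigma> permutes {0..<n}"
      and B: "ordered_submatrix B (perm_mat (s n0) n \<sigma>)"
      unfolding perm_class_iff by blast
    obtain n' where n': "s n' = s n0" "n \<le> n'"
      using inf unfolding infinite_nat_iff_unbounded_le by blast
    have "\<sigma> permutes {0..<n'}" using \<sigma> n'(2) by (auto intro: permutes_subset)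
    then have M': "perm_mat (s n0) n' \<sigma> \<in> M" using s n'(1) by metis
    have "perm_mat (s n0) n \<sigma> = mat n n (\<lambda>(i, j). perm_mat (s n0) n' \<sigma> $$ (i, j))"
      using n'(2) by (intro eq_matI) auto
    moreover have "ordered_submatrix (mat n n (\<lambda>(i, j). perm_mat (s n0) n' \<sigma> $$ (i, j))) (perm_mat (s n0) n' \<sigma>)"
      using n'(2) by (intro ordered_submatrixI) (auto simp: strict_mono_on_def)
    ultimately have "ordered_submatrix (perm_mat (s n0) n \<sigma>) (perm_mat (s n0) n' \<sigma>)" by simp
    then show "B \<in> M" using M(1) M' B ordered_submatrix_trans unfolding matrix_class_iff by blast
  qed
  then show ?thesis by blast
qed

section \<open>Growth of classes without rich divisions\<close>

lemma zero_one_eqI: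
  assumes "zero_one_mat A" "zero_one_mat A'" "A \<in> carrier_mat n1 n2" "A' \<in> carrier_mat n1 n2"
    and "\<And>i j. i < n1 \<Longrightarrow> j < n2 \<Longrightarrow> ones A i j = ones A' i j"
  shows "A = A'"
proof (rule eq_matI)
  fix i j assume "i < dim_row A'" "j < dim_col A'"
  then show "A $$ (i, j) = A' $$ (i, j)"
    using zero_one_index[OF assms(1), of i j] zero_one_index[OF assms(2), of i j] assms(3-5) by simp
qed (use assms(3,4) in auto)

lemma card_zero_one:
  assumes "\<forall>A\<in>M. zero_one_mat A"
  shows "finite (M \<inter> carrier_mat n1 n2) \<and> card (M \<inter> carrier_mat n1 n2) \<le> 2 ^ (n1 * n2)"
proof -
  define F where "F A = {(i, j). i < n1 \<and> j < n2 \<and> ones A i j}" for A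
  have inj: "inj_on F (M \<inter> carrier_mat n1 n2)"
  proof (rule inj_onI)
    fix A A' assume A: "A \<in> M \<inter> carrier_mat n1 n2" "A' \<in> M \<inter> carrier_mat n1 n2" "F A = F A'"
    then have "ones A i j = ones A' i j" if "i < n1" "j < n2" for i j
      using that by (auto simp: F_def set_eq_iff)
    then show "A = A'" using A assms by (intro zero_one_eqI[of A A' n1 n2]) auto
  qed
  have sub: "F ` (M \<inter> carrier_mat n1 n2) \<subseteq> Pow ({..<n1} \<times> {..<n2})" by (auto simp: F_def)
  have fin: "finite (Pow ({..<n1} \<times> {..<n2}))" by simp
  have "card (M \<inter> carrier_mat n1 n2) \<le> card (Pow ({..<n1} \<times> {..<n2}))"
    by (rule card_inj_on_le[OF inj sub fin])
  then show ?thesis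
    using inj_on_finite[OF inj sub fin] by (simp add: card_Pow)
qed

lemma card_le_encoding:
  assumes "finite D" "\<And>A. A \<in> S \<Longrightarrow> \<exists>d\<in>D. enc A d"
    and "\<And>A A' d. A \<in> S \<Longrightarrow> A' \<in> S \<Longrightarrow> enc A d \<Longrightarrow> enc A' d \<Longrightarrow> A = A'"
  shows "card S \<le> card D"
proof -
  from assms(2) obtain g where g: "\<And>A. A \<in> S \<Longrightarrow> g A \<in> D \<and> enc A (g A)" by metis
  have "inj_on g S" using g assms(3) by (metis inj_onI)
  then show ?thesis using g assms(1) by (intro card_inj_on_le[of g]) auto
qed

lemma submatrix_rows_cong:
  assumes "submatrix A (- X) UNIV = submatrix A' (- X) UNIV"
    and "A \<in> carrier_mat n1 n2" "A' \<in> carrier_mat n1 n2" "i < n1" "i \<notin> X" "j < n2"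
  shows "A $$ (i, j) = A' $$ (i, j)"
  using submatrix_index_card[of i A j "- X" UNIV] submatrix_index_card[of i A' j "- X" UNIV] assms
  by auto

text \<open>
  A matrix is encoded by its rich cells, the ones in these cells, the pairs of rows from
  \<open>deletable_rows\<close>, and the submatrix that is left after the deletion of the rows. All but the last
  component take O(n1) bits: the positions of the rich cells by Klazar's bound, their contents by
  the Marcus-Tardos bound, and the pairs since the two rows of a pair lie in a common block.
\<close>

theorem row_deletion_count:
  "\<exists>L C. L > 1 \<and> (\<forall>M n1 n2. matrix_class M \<longrightarrow> (\<forall>A\<in>M. zero_one_mat A) \<longrightarrow>
    (\<forall>A\<in>M. \<not> rich_division k (dim_row A) (dim_col A) (ones A)) \<longrightarrow> n2 \<le> n1 \<longrightarrow> L \<le> n1 \<longrightarrow>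
    card (M \<inter> carrier_mat n1 n2)
      \<le> 2 ^ (C * n1) * card (M \<inter> carrier_mat (n1 - (n1 div L + 1) div 2) n2))"
proof -
  obtain L where L: "L > 1" and del: "\<forall>a n1 n2. n2 \<le> n1 \<longrightarrow> L \<le> n1 \<longrightarrow> \<not> rich_division k n1 n2 a \<longrightarrow>
    (\<exists>Q Rich. Q \<subseteq> {(x, y). x < n1 \<and> y < n1 \<and> x div L = y div L} \<and>
      card (fst ` Q) = (n1 div L + 1) div 2 \<and> fst ` Q \<inter> snd ` Q = {} \<and>
      Rich \<in> grid_free_sets k (Suc (n1 div L)) \<and>
      (\<forall>(x, y)\<in>Q. \<forall>j<n2. (x div L, j div L) \<notin> Rich \<longrightarrow> a x j = a y j))"
    using deletable_rows[of k] by (elim exE conjE)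
  obtain C1 where C1: "\<And>n. card (grid_free_sets k n) \<le> 2 ^ (C1 * n)"
    using Klazar_count by blast
  obtain C2 where C2: "\<And>n P. P \<subseteq> {..<n} \<times> {..<n} \<Longrightarrow> \<not> has_grid k P \<Longrightarrow> card P \<le> C2 * n"
    using Marcus_Tardos_grid by blast
  define C where "C = C1 + L * L * C2 + L"
  have "card (M \<inter> carrier_mat n1 n2)
      \<le> 2 ^ (C * n1) * card (M \<inter> carrier_mat (n1 - (n1 div L + 1) div 2) n2)"
    if M: "matrix_class M" "\<forall>A\<in>M. zero_one_mat A"
      "\<forall>A\<in>M. \<not> rich_division k (dim_row A) (dim_col A) (ones A)" and n: "n2 \<le> n1" "L \<le> n1" for M n1 n2
  proof -
    define m where "m = Suc (n1 div L)"
    define M' where "M' = M \<inter> carrier_mat (n1 - (n1 div L + 1) div 2) n2"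
    define blow where "blow Rich = {(i, j). (i div L, j div L) \<in> Rich}" for Rich :: "(nat \<times> nat) set"
    define pairs where "pairs = {(x, y). x < n1 \<and> y < n1 \<and> x div L = y div L}"
    define DR where "DR = (SIGMA Rich:grid_free_sets k m. Pow (blow Rich))"
    have L0: "L > 0" using L by simp
    have m: "m \<le> n1"
    proof -
      have "n1 div L \<le> n1 div 2" using L by (intro div_le_mono2) simp_all
      then show ?thesis using L n(2) by (simp add: m_def)
    qed
    have finM': "finite M'" unfolding M'_def using card_zero_one[OF M(2)] by blast
    have pairs_sub: "pairs \<subseteq> (SIGMA x:{..<n1}. block L (x div L))" by (auto simp: pairs_def)
    have finS: "finite (SIGMA x:{..<n1}. block L (x div L))" using L0 by (simp add: finite_block)
    have "card pairs \<le> card (SIGMA x:{..<n1}. block L (x div L))"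
      by (rule card_mono[OF finS pairs_sub])
    also have "\<dots> = n1 * L" using L0 by (simp add: finite_block card_block)
    finally have pairs: "finite pairs" "card pairs \<le> n1 * L"
      using finite_subset[OF pairs_sub finS] by simp_all
    have blow: "finite (blow Rich)" "card (blow Rich) \<le> L * L * (C2 * m)" if "Rich \<in> grid_free_sets k m" for Rich
    proof -
      have R: "Rich \<subseteq> {..<m} \<times> {..<m}" "\<not> has_grid k Rich" using that by (simp_all add: grid_free_sets_def)
      then have fin: "finite Rich" by (intro finite_subset[OF R(1)]) simp
      from card_preimage_contract[OF L0 fin] have *: "finite (blow Rich)" "card (blow Rich) \<le> L * L * card Rich"
        unfolding blow_def by blast+
      show "finite (blow Rich)" by (rule *)
      have "L * L * card Rich \<le> L * L * (C2 * m)" by (intro mult_le_mono2 C2 R)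
      with *(2) show "card (blow Rich) \<le> L * L * (C2 * m)" by linarith
    qed
    have finDR: "finite DR" unfolding DR_def
      using finite_grid_free_sets blow(1) by (intro finite_SigmaI) simp_all
    have cDR: "card DR \<le> 2 ^ (C1 * m + L * L * (C2 * m))"
    proof -
      have "card DR = (\<Sum>Rich\<in>grid_free_sets k m. card (Pow (blow Rich)))"
        unfolding DR_def using finite_grid_free_sets blow(1) by (intro card_SigmaI) simp_all
      also have "\<dots> \<le> (\<Sum>Rich\<in>grid_free_sets k m. 2 ^ (L * L * (C2 * m)))"
        using blow by (intro sum_mono) (simp add: card_Pow)
      also have "\<dots> \<le> 2 ^ (C1 * m) * 2 ^ (L * L * (C2 * m))" using C1[of m] by simp
      finally show ?thesis by (simp only: power_add)
    qed
    define enc where "enc A d \<longleftrightarrow> (case d of ((Rich, E), Q, B) \<Rightarrow>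
       E = {(i, j). (i div L, j div L) \<in> Rich \<and> ones A i j} \<and> B = submatrix A (- (fst ` Q)) UNIV \<and>
       fst ` Q \<inter> snd ` Q = {} \<and> Q \<subseteq> pairs \<and>
       (\<forall>(x, y)\<in>Q. \<forall>j<n2. (x div L, j div L) \<notin> Rich \<longrightarrow> ones A x j = ones A y j))" for A d
    have "card (M \<inter> carrier_mat n1 n2) \<le> card (DR \<times> Pow pairs \<times> M')"
    proof (rule card_le_encoding[where enc = enc])
      show "finite (DR \<times> Pow pairs \<times> M')" using finDR pairs(1) finM' by simp
    next
      fix A assume A: "A \<in> M \<inter> carrier_mat n1 n2"
      then have "\<not> rich_division k n1 n2 (ones A)" using M(3) by auto
      from del[THEN spec, THEN spec, THEN spec, THEN mp, THEN mp, THEN mp, OF n this] obtain Q Rich where QR: "Q \<subseteq> pairs"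
        "card (fst ` Q) = (n1 div L + 1) div 2" "fst ` Q \<inter> snd ` Q = {}"
        "Rich \<in> grid_free_sets k m"
        "\<forall>(x, y)\<in>Q. \<forall>j<n2. (x div L, j div L) \<notin> Rich \<longrightarrow> ones A x j = ones A y j"
        unfolding pairs_def m_def by (elim exE conjE)
      define B where "B = submatrix A (- (fst ` Q)) UNIV"
      define E where "E = {(i, j). (i div L, j div L) \<in> Rich \<and> ones A i j}"
      have "B \<in> M'"
      proof -
        have "B \<in> M" using M(1) A unfolding matrix_class_def B_def by blast
        moreover have "{i. i < n1 \<and> i \<in> - (fst ` Q)} = {..<n1} - fst ` Q" by auto
        moreover have "fst ` Q \<subseteq> {..<n1}" using QR(1) by (auto simp: pairs_def)
        ultimately show ?thesis
          using A QR(2) by (auto simp: M'_def B_def dim_submatrix card_Diff_subset finite_subset intro!: carrier_matI)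
      qed
      moreover have "(Rich, E) \<in> DR" using QR(4) by (auto simp: DR_def E_def blow_def)
      ultimately have "((Rich, E), Q, B) \<in> DR \<times> Pow pairs \<times> M'" using QR(1) by simp
      moreover have "enc A ((Rich, E), Q, B)"
        using QR by (simp add: enc_def B_def E_def)
      ultimately show "\<exists>d\<in>DR \<times> Pow pairs \<times> M'. enc A d" by blast
    next
      fix A A' d assume A: "A \<in> M \<inter> carrier_mat n1 n2" "A' \<in> M \<inter> carrier_mat n1 n2"
        and e: "enc A d" "enc A' d"
      obtain Rich E Q B where d: "d = ((Rich, E), Q, B)" by (metis surj_pair)
      have E: "{(i, j). (i div L, j div L) \<in> Rich \<and> ones A i j} = {(i, j). (i div L, j div L) \<in> Rich \<and> ones A' i j}"
        and B: "submatrix A (- (fst ` Q)) UNIV = submatrix A' (- (fst ` Q)) UNIV"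
        and Q: "fst ` Q \<inter> snd ` Q = {}" "Q \<subseteq> pairs"
        and cp: "\<And>x y j. (x, y) \<in> Q \<Longrightarrow> j < n2 \<Longrightarrow> (x div L, j div L) \<notin> Rich \<Longrightarrow>
          ones A x j = ones A y j \<and> ones A' x j = ones A' y j"
        using e unfolding enc_def d by auto
      have keep: "ones A i j = ones A' i j" if "i < n1" "j < n2" "i \<notin> fst ` Q" for i j
        using submatrix_rows_cong[OF B _ _ that(1,3,2)] A by (simp add: ones_def)
      have "ones A i j = ones A' i j" if ij: "i < n1" "j < n2" for i j
      proof (cases "i \<in> fst ` Q")
        case True
        then obtain y where y: "(i, y) \<in> Q" by auto
        show ?thesis
        proof (cases "(i div L, j div L) \<in> Rich")
          case True
          then show ?thesis using E by (auto simp: set_eq_iff)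
        next
          case False
          have "y < n1" using y Q(2) by (auto simp: pairs_def)
          moreover have "y \<notin> fst ` Q" using y Q(1) by force
          ultimately show ?thesis using cp[OF y ij(2) False] keep[of y j] ij(2) by simp
        qed
      qed (use keep ij in simp)
      then show "A = A'" using A M(2) by (intro zero_one_eqI[of A A' n1 n2]) auto
    qed
    also have "\<dots> = card DR * 2 ^ card pairs * card M'"
      using pairs(1) by (simp add: card_cartesian_product card_Pow)
    also have "\<dots> \<le> 2 ^ (C * n1) * card M'"
    proof (rule mult_right_mono)
      have "card DR * 2 ^ card pairs \<le> 2 ^ (C1 * m + L * L * (C2 * m)) * 2 ^ (n1 * L)"
        using cDR pairs(2) by (intro mult_mono power_increasing) simp_all
      also have "\<dots> = 2 ^ (C1 * m + L * L * (C2 * m) + n1 * L)" by (simp only: power_add)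
      also have "\<dots> \<le> 2 ^ (C * n1)"
      proof (rule power_increasing)
        have "C1 * m + L * L * (C2 * m) + n1 * L \<le> C1 * n1 + L * L * (C2 * n1) + n1 * L"
          using m by (intro add_mono mult_le_mono2) simp_all
        also have "\<dots> = C * n1" by (simp add: C_def algebra_simps)
        finally show "C1 * m + L * L * (C2 * m) + n1 * L \<le> C * n1" .
      qed simp
      finally show "card DR * 2 ^ card pairs \<le> 2 ^ (C * n1)" .
    qed simp
    finally show ?thesis by (simp only: M'_def)
  qed
  then show ?thesis using L by blast
qed

lemma card_transpose_class:
  "card (transpose_mat ` M \<inter> carrier_mat n1 n2) = card (M \<inter> carrier_mat n2 n1)"
proof -
  have "transpose_mat ` M \<inter> carrier_mat n1 n2 = transpose_mat ` (M \<inter> carrier_mat n2 n1)"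
    by auto
  moreover have "inj_on transpose_mat (M \<inter> carrier_mat n2 n1)"
    by (metis inj_onI transpose_transpose)
  ultimately show ?thesis by (simp add: card_image)
qed

lemma zero_one_transpose: "zero_one_mat A \<Longrightarrow> zero_one_mat (transpose_mat A)"
proof -
  have "elements_mat (transpose_mat A) \<subseteq> elements_mat A"
  proof
    fix x assume "x \<in> elements_mat (transpose_mat A)"
    from elements_matD[OF this] obtain i j where
      ij: "i < dim_col A" "j < dim_row A" "x = transpose_mat A $$ (i, j)" by auto
    then have "x = A $$ (j, i)" by simp
    then show "x \<in> elements_mat A" using ij by (intro elements_matI[OF carrier_matI[OF refl refl]])
  qed
  then show "zero_one_mat A \<Longrightarrow> zero_one_mat (transpose_mat A)"
    unfolding zero_one_mat_def by blast
qed

text \<open>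
  Deleting rows and then, in the transposed class, columns reduces the side n to n - h with h
  proportional to n, at the price of a factor of 2^(2 C n).
\<close>

theorem poor_class_growth:
  assumes M: "matrix_class M" "\<forall>A\<in>M. zero_one_mat A"
    and poor: "\<forall>A\<in>M. \<not> rich_division k (dim_row A) (dim_col A) (ones A)"
    and poor': "\<forall>A\<in>transpose_mat ` M. \<not> rich_division k (dim_row A) (dim_col A) (ones A)"
  shows "\<exists>K. \<forall>n. growth M n \<le> 2 ^ (K * n)"
proof -
  obtain L C where L: "L > 1" and step0: "\<forall>M n1 n2. matrix_class M \<longrightarrow> (\<forall>A\<in>M. zero_one_mat A) \<longrightarrow>
    (\<forall>A\<in>M. \<not> rich_division k (dim_row A) (dim_col A) (ones A)) \<longrightarrow> n2 \<le> n1 \<longrightarrow> L \<le> n1 \<longrightarrow>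
    card (M \<inter> carrier_mat n1 n2)
      \<le> 2 ^ (C * n1) * card (M \<inter> carrier_mat (n1 - (n1 div L + 1) div 2) n2)"
    using row_deletion_count[of k] by (elim exE conjE)
  note step = step0[THEN spec, THEN spec, THEN spec, THEN mp, THEN mp, THEN mp, THEN mp, THEN mp]
  \<comment> \<open>As n \<le> 4 L h, the first summand pays for 2 C n; the second one covers n < L.\<close>
  define K where "K = 8 * C * L + L"
  have "growth M n \<le> 2 ^ (K * n)" for n
  proof (induction n rule: less_induct)
    case (less n)
    show ?case
    proof (cases "n < L")
      case True
      have "growth M n \<le> 2 ^ (n * n)" unfolding growth_def using card_zero_one[OF M(2)] by blast
      also have "\<dots> \<le> 2 ^ (K * n)"
        using True by (intro power_increasing mult_le_mono1) (simp_all add: K_def)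
      finally show ?thesis .
    next
      case False
      then have Ln: "L \<le> n" by simp
      define h where "h = (n div L + 1) div 2"
      have N: "n div L \<ge> 1" using Ln L by (simp add: less_eq_div_iff_mult_less_eq)
      have h: "1 \<le> h" "n div L + 1 \<le> 4 * h" using N unfolding h_def by linarith+
      have hn: "h \<le> n" using div_le_dividend[of n L] L Ln unfolding h_def by linarith
      have "n < L * (n div L + 1)"
        using dividend_less_times_div[of L n] L by (simp add: algebra_simps)
      also have "\<dots> \<le> L * (4 * h)" using h(2) by (rule mult_le_mono2)
      finally have nh: "n \<le> 4 * L * h" by simp
      have "growth M n \<le> 2 ^ (C * n) * card (M \<inter> carrier_mat (n - h) n)"
        unfolding growth_def h_def using step[OF M poor, of n n] Ln by simp
      also have "card (M \<inter> carrier_mat (n - h) n) = card (transpose_mat ` M \<inter> carrier_mat n (n - h))"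
        by (simp add: card_transpose_class)
      also have "\<dots> \<le> 2 ^ (C * n) * card (transpose_mat ` M \<inter> carrier_mat (n - h) (n - h))"
        unfolding h_def using M(2) zero_one_transpose
        by (intro step matrix_class_transpose[OF M(1)] poor' Ln) auto
      also have "card (transpose_mat ` M \<inter> carrier_mat (n - h) (n - h)) = growth M (n - h)"
        by (simp add: card_transpose_class growth_def)
      also have "growth M (n - h) \<le> 2 ^ (K * (n - h))"
        using less.IH[of "n - h"] h(1) Ln L by simp
      finally have "growth M n \<le> 2 ^ (C * n) * (2 ^ (C * n) * 2 ^ (K * (n - h)))"
        by simp
      also have "\<dots> = 2 ^ (2 * C * n + K * (n - h))" by (simp add: power_add[symmetric] algebra_simps mult_2)
      also have "\<dots> \<le> 2 ^ (K * n)"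
      proof (rule power_increasing)
        have "2 * C * n \<le> 2 * C * (4 * L * h)" using nh by (rule mult_le_mono2)
        also have "\<dots> \<le> K * h" by (simp add: K_def algebra_simps)
        finally have "2 * C * n + K * (n - h) \<le> K * h + K * (n - h)" by simp
        also have "\<dots> = K * n" using hn by (simp add: distrib_left[symmetric])
        finally show "2 * C * n + K * (n - h) \<le> K * n" .
      qed simp
      finally show ?thesis .
    qed
  qed
  then show ?thesis by blast
qed

lemma rich_division_antimono:
  assumes "rich_division k n1 n2 a" "l \<le> k"
  shows "rich_division l n1 n2 a"
proof -
  from assms(1) obtain r c where rc: "mono r" "mono c"
    "\<forall>x<k. \<forall>y<k. k \<le> card (col_types a ({r x..<r (Suc x)} \<inter> {..<n1}) ({c y..<c (Suc y)} \<inter> {..<n2}))"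
    unfolding rich_division_def by blast
  have "l \<le> card (col_types a ({r x..<r (Suc x)} \<inter> {..<n1}) ({c y..<c (Suc y)} \<inter> {..<n2}))"
    if "x < l" "y < l" for x y
    using rc(3)[rule_format, of x y] that assms(2) by linarith
  then show ?thesis
    unfolding rich_division_def using rc(1,2) by (intro exI[of _ r] exI[of _ c]) simp
qed

text \<open>
  The two notions of a division, with many distinct columns or with many distinct rows in each cell,
  are exchanged by transposition. Either of them, if available for all k, yields one of the six classes.
\<close>

theorem growth_dichotomy:
  assumes M: "matrix_class M" "\<forall>A\<in>M. zero_one_mat A"
  shows "(\<exists>s. perm_class s \<subseteq> M) \<or> growth_exp_linear M"
proof (rule disjCI)
  assume nl: "\<not> growth_exp_linear M"
  let ?poor = "\<lambda>M k. \<forall>A\<in>M. \<not> rich_division k (dim_row A) (dim_col A) (ones A)"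
  let ?MT = "transpose_mat ` M"
  have MT: "matrix_class ?MT" "\<forall>A\<in>?MT. zero_one_mat A"
    using matrix_class_transpose[OF M(1)] M(2) zero_one_transpose by auto
  have "\<not> (?poor M k \<and> ?poor ?MT l)" for k l
  proof
    assume "?poor M k \<and> ?poor ?MT l"
    then have "?poor M (max k l)" "?poor ?MT (max k l)"
      by (meson rich_division_antimono max.cobounded1 max.cobounded2)+
    from poor_class_growth[OF M this] obtain K where K: "\<And>n. growth M n \<le> 2 ^ (K * n)" by blast
    have "real (growth M n) \<le> 2 powr (real K * real n)" for n
    proof -
      have "real (growth M n) \<le> real (2 ^ (K * n))" using K[of n] by (rule of_nat_mono)
      also have "\<dots> = 2 powr (real K * real n)" by (simp add: powr_realpow[symmetric])
      finally show ?thesis .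
    qed
    then have "growth_exp_linear M" unfolding growth_exp_linear_def
      by (intro exI[of _ "\<lambda>n. real K * real n"]) simp
    with nl show False by contradiction
  qed
  then have "(\<forall>k. \<not> ?poor M k) \<or> (\<forall>k. \<not> ?poor ?MT k)" by blast
  then show "\<exists>s. perm_class s \<subseteq> M"
    using rich_class_contains_perm_class[OF M] rich_class_contains_perm_class[OF MT]
      transpose_perm_class by meson
qed

section \<open>The six classes\<close>

lemma perm_mat_inj:
  assumes \<sigma>: "\<sigma> permutes {0..<n}" and \<tau>: "\<tau> permutes {0..<n}" and eq: "perm_mat s n \<sigma> = perm_mat s n \<tau>"
  shows "\<sigma> = \<tau>"
proof -
  have e: "entry_one s \<sigma> i j = entry_one s \<tau> i j" if "i < n" "j < n" for i j
    using arg_cong[OF eq, of "\<lambda>A. A $$ (i, j)"] that by (simp split: if_splits)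
  have bd: "\<rho> i < n" if "\<rho> permutes {0..<n}" "i < n" for \<rho> i
    using permutes_in_image[OF that(1), of i] that(2) by simp
  have ext: "\<rho> = \<pi>" if "\<rho> permutes {0..<n}" "\<pi> permutes {0..<n}" "\<And>i. i < n \<Longrightarrow> \<rho> i = \<pi> i" for \<rho> \<pi>
  proof
    fix i show "\<rho> i = \<pi> i"
      using that(3)[of i] permutes_not_in[OF that(1), of i] permutes_not_in[OF that(2), of i]
      by (cases "i < n") auto
  qed
  let ?\<sigma> = "inv_into UNIV \<sigma>" and ?\<tau> = "inv_into UNIV \<tau>"
  have inv: "?\<sigma> permutes {0..<n}" "?\<tau> permutes {0..<n}"
    using permutes_inv \<sigma> \<tau> by blast+
  have by_rows: "\<sigma> = \<tau>" if "\<And>i. i < n \<Longrightarrow> \<sigma> i = \<tau> i"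
    using ext[OF \<sigma> \<tau> that] .
  have by_cols: "\<sigma> = \<tau>" if "\<And>i. i < n \<Longrightarrow> ?\<sigma> i = ?\<tau> i"
    using ext[OF inv that] inv_inv_eq[OF permutes_bij[OF \<sigma>]] inv_inv_eq[OF permutes_bij[OF \<tau>]] by metis
  show ?thesis
  proof (cases s)
    case Eq
    then show ?thesis using e bd[OF \<sigma>] by (intro by_rows) (metis entry_one.simps(1))
  next
    case Neq
    then show ?thesis using e bd[OF \<sigma>] by (intro by_rows) (metis entry_one.simps(2))
  next
    case LeR
    then have "i \<le> ?\<sigma> j \<longleftrightarrow> i \<le> ?\<tau> j" if "i < n" "j < n" for i j using e[OF that] by simp
    then show ?thesis using bd[OF inv(1)] bd[OF inv(2)] by (intro by_cols) (metis le_antisym order_refl)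
  next
    case GeR
    then have "i \<ge> ?\<sigma> j \<longleftrightarrow> i \<ge> ?\<tau> j" if "i < n" "j < n" for i j using e[OF that] by simp
    then show ?thesis using bd[OF inv(1)] bd[OF inv(2)] by (intro by_cols) (metis le_antisym order_refl)
  next
    case LeC
    then have "j \<le> \<sigma> i \<longleftrightarrow> j \<le> \<tau> i" if "i < n" "j < n" for i j using e[OF that] by simp
    then show ?thesis using bd[OF \<sigma>] bd[OF \<tau>] by (intro by_rows) (metis le_antisym order_refl)
  next
    case GeC
    then have "j \<ge> \<sigma> i \<longleftrightarrow> j \<ge> \<tau> i" if "i < n" "j < n" for i j using e[OF that] by simp
    then show ?thesis using bd[OF \<sigma>] bd[OF \<tau>] by (intro by_rows) (metis le_antisym order_refl)
  qed
qed

lemma zero_one_perm_class: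
  assumes "B \<in> perm_class s"
  shows "zero_one_mat B"
  unfolding zero_one_mat_def
proof
  fix x assume "x \<in> elements_mat B"
  from elements_matD[OF this] obtain i j where ij: "i < dim_row B" "j < dim_col B" "x = B $$ (i, j)" by auto
  from assms obtain n \<sigma> where "ordered_submatrix B (perm_mat s n \<sigma>)"
    unfolding perm_class_iff by blast
  then obtain f g where fg: "f ` {..<dim_row B} \<subseteq> {..<n}" "g ` {..<dim_col B} \<subseteq> {..<n}"
    "B $$ (i, j) = perm_mat s n \<sigma> $$ (f i, g j)"
    unfolding ordered_submatrix_def using ij by (elim exE conjE) simp
  have "f i < n" "g j < n" using fg(1,2) ij by auto
  with ij fg(3) show "x \<in> {0, 1}" by simp
qed

text \<open>
  The case n = 0 is covered by the empty submatrix.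
\<close>

lemma fact_le_growth_perm_class: "fact n \<le> growth (perm_class s) n"
proof -
  have fin: "finite (perm_class s \<inter> carrier_mat n n)"
    using card_zero_one[of "perm_class s" n n] zero_one_perm_class by blast
  show ?thesis
  proof (cases "n = 0")
    case True
    have "id permutes {0..<1::nat}" by (rule permutes_id)
    moreover have "ordered_submatrix (mat 0 0 (\<lambda>_. 0)) (perm_mat s 1 id)"
      unfolding ordered_submatrix_def by (auto simp: strict_mono_on_def)
    ultimately have "mat 0 0 (\<lambda>_. 0) \<in> perm_class s" unfolding perm_class_iff by blast
    then have "mat 0 0 (\<lambda>_. 0) \<in> perm_class s \<inter> carrier_mat n n" using True by simp
    then have "card (perm_class s \<inter> carrier_mat n n) > 0" using fin by (metis card_gt_0_iff empty_iff)
    then show ?thesis using True by (simp add: growth_def)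
  next
    case False
    let ?S = "{\<sigma>. \<sigma> permutes {0..<n}}"
    have "inj_on (perm_mat s n) ?S" by (rule inj_onI) (use perm_mat_inj in blast)
    moreover have "perm_mat s n ` ?S \<subseteq> perm_class s \<inter> carrier_mat n n"
    proof
      fix B assume "B \<in> perm_mat s n ` ?S"
      then obtain \<sigma> where \<sigma>: "\<sigma> permutes {0..<n}" "B = perm_mat s n \<sigma>" by blast
      have "1 \<le> n \<and> \<sigma> permutes {0..<n} \<and> ordered_submatrix B (perm_mat s n \<sigma>)"
        using False \<sigma> ordered_submatrix_refl[of B] by simp
      then have "B \<in> perm_class s" unfolding perm_class_iff by blast
      then show "B \<in> perm_class s \<inter> carrier_mat n n" using \<sigma>(2) by (simp add: perm_mat_def)
    qed
    ultimately have "card ?S \<le> card (perm_class s \<inter> carrier_mat n n)" using fin by (rule card_inj_on_le)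
    moreover have "card ?S = fact n" by (rule card_permutations) simp_all
    ultimately show ?thesis by (simp add: growth_def)
  qed
qed

text \<open>
  Since c^n / n! tends to 0 for every c, eventually n! exceeds 2^(Z n) for every Z.
\<close>

lemma log_fact_superlinear: "filterlim (\<lambda>n. log 2 (fact n) / real n) at_top sequentially"
  unfolding filterlim_at_top
proof
  fix Z :: real
  define c where "c = 2 powr Z"
  have c: "c > 0" by (simp add: c_def)
  have "(\<lambda>n. inverse (fact n) * c ^ n) \<longlonglongrightarrow> 0"
    using summable_LIMSEQ_zero[OF summable_exp[of c]] by simp
  then have "\<forall>\<^sub>F n in sequentially. inverse (fact n) * c ^ n < 1"
    by (rule order_tendstoD) simp
  then show "\<forall>\<^sub>F n in sequentially. Z \<le> log 2 (fact n) / real n"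
    using eventually_gt_at_top[of 0]
  proof eventually_elim
    case (elim n)
    have "c ^ n \<le> fact n" using elim(1) by (simp add: field_simps)
    then have "log 2 (c ^ n) \<le> log 2 (fact n)" using c by (intro log_mono) simp_all
    moreover have "log 2 (c ^ n) = real n * Z" using c by (simp add: log_nat_power c_def)
    ultimately show ?case using elim(2) by (simp add: field_simps)
  qed
qed

lemma superlinear_perm_class: "growth_exp_superlinear (perm_class s)"
  unfolding growth_exp_superlinear_def
proof (intro exI conjI allI)
  let ?f = "\<lambda>n. log 2 (real (growth (perm_class s) n))"
  have fact: "fact n \<le> real (growth (perm_class s) n)" for n
    using of_nat_mono[OF fact_le_growth_perm_class[of n s], where ?'a = real] by simp
  have pos: "0 < real (growth (perm_class s) n)" for n
    using fact[of n] fact_gt_zero[of n, where ?'a = real] by linarith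
  show "real (growth (perm_class s) n) = 2 powr ?f n" for n
    using pos[of n] by simp
  show "filterlim (\<lambda>n. ?f n / real n) at_top sequentially"
  proof (rule filterlim_at_top_mono[OF log_fact_superlinear], rule always_eventually, rule allI)
    fix n
    have "log 2 (fact n) \<le> ?f n" using fact[of n] by (intro log_mono) simp_all
    then show "log 2 (fact n) / real n \<le> ?f n / real n" by (intro divide_right_mono) simp_all
  qed
qed

lemma superlinear_not_linear:
  assumes "growth_exp_superlinear M"
  shows "\<not> growth_exp_linear M"
proof
  assume "growth_exp_linear M"
  then obtain g where g: "g \<in> O(\<lambda>n. real n)" "\<And>n. real (growth M n) \<le> 2 powr g n"
    unfolding growth_exp_linear_def by blast
  from assms obtain f where f: "\<And>n. real (growth M n) = 2 powr f n"
    "filterlim (\<lambda>n. f n / real n) at_top sequentially"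
    unfolding growth_exp_superlinear_def by blast
  from g(1) obtain c where c: "\<forall>\<^sub>F n in sequentially. norm (g n) \<le> c * norm (real n)"
    by (rule landau_o.bigE)
  have "\<forall>\<^sub>F n in sequentially. c + 1 \<le> f n / real n"
    using f(2) unfolding filterlim_at_top by blast
  with c have "\<forall>\<^sub>F n in sequentially. False"
    using eventually_gt_at_top[of 0]
  proof eventually_elim
    case (elim n)
    have "2 powr f n \<le> 2 powr g n" using f(1)[of n] g(2)[of n] by simp
    then have "f n \<le> g n" by simp
    also have "\<dots> \<le> c * real n" using elim(1) by simp
    finally have "f n / real n \<le> c" using elim(3) by (simp add: field_simps)
    with elim(2) show False by simp
  qed
  then show False by simp
qed

text \<open>
  Properties that are inherited by submatrices and tell the six classes apart: at most one 1, or one 0,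
  in a row; and columns or rows that are monotone in one of the two directions.
\<close>

fun shape :: "kind \<Rightarrow> nat mat \<Rightarrow> bool" where
  "shape Eq A \<longleftrightarrow> (\<forall>i<dim_row A. \<forall>j<dim_col A. \<forall>j'<dim_col A. j < j' \<longrightarrow> \<not> (A $$ (i, j) = 1 \<and> A $$ (i, j') = 1))"
| "shape Neq A \<longleftrightarrow> (\<forall>i<dim_row A. \<forall>j<dim_col A. \<forall>j'<dim_col A. j < j' \<longrightarrow> \<not> (A $$ (i, j) = 0 \<and> A $$ (i, j') = 0))"
| "shape LeR A \<longleftrightarrow> (\<forall>j<dim_col A. \<forall>i<dim_row A. \<forall>i'<dim_row A. i < i' \<longrightarrow> A $$ (i', j) = 1 \<longrightarrow> A $$ (i, j) = 1)"
| "shape GeR A \<longleftrightarrow> (\<forall>j<dim_col A. \<forall>i<dim_row A. \<forall>i'<dim_row A. i < i' \<longrightarrow> A $$ (i, j) = 1 \<longrightarrow> A $$ (i', j) = 1)"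
| "shape LeC A \<longleftrightarrow> (\<forall>i<dim_row A. \<forall>j<dim_col A. \<forall>j'<dim_col A. j < j' \<longrightarrow> A $$ (i, j') = 1 \<longrightarrow> A $$ (i, j) = 1)"
| "shape GeC A \<longleftrightarrow> (\<forall>i<dim_row A. \<forall>j<dim_col A. \<forall>j'<dim_col A. j < j' \<longrightarrow> A $$ (i, j) = 1 \<longrightarrow> A $$ (i, j') = 1)"

lemma shape_ordered_submatrix:
  assumes "ordered_submatrix B A" "shape s A"
  shows "shape s B"
proof -
  obtain f g where fg: "strict_mono_on {..<dim_row B} f" "strict_mono_on {..<dim_col B} g"
      "f ` {..<dim_row B} \<subseteq> {..<dim_row A}" "g ` {..<dim_col B} \<subseteq> {..<dim_col A}"
      "\<And>i j. i < dim_row B \<Longrightarrow> j < dim_col B \<Longrightarrow> B $$ (i, j) = A $$ (f i, g j)"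
    using assms(1) unfolding ordered_submatrix_def by (elim exE conjE) simp
  have f: "f i < dim_row A" if "i < dim_row B" for i using fg(3) that by auto
  have g: "g i < dim_col A" if "i < dim_col B" for i using fg(4) that by auto
  have sf: "f i < f i'" if "i < i'" "i' < dim_row B" for i i'
    using fg(1) that by (auto simp: strict_mono_on_def)
  have sg: "g i < g i'" if "i < i'" "i' < dim_col B" for i i'
    using fg(2) that by (auto simp: strict_mono_on_def)
  show ?thesis
    using assms(2) f g sf sg fg(5) by (cases s) (simp; metis)+
qed

lemma shape_perm_mat: "shape s (perm_mat s n \<sigma>)"
  by (cases s) auto

text \<open>
  A single permutation that separates all six kinds: its matrix of one kind has the shape of no other
  kind.
\<close>

definition cycle3 :: "nat \<Rightarrow> nat" where
  "cycle3 i = (if i = 0 then 1 else if i = 1 then 2 else if i = 2 then 0 else i)"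

lemma not_shape_cycle3:
  assumes "s \<noteq> s'"
  shows "\<not> shape s' (perm_mat s 3 cycle3)"
proof -
  have all3: "(\<forall>i<(3::nat). P i) \<longleftrightarrow> P 0 \<and> P 1 \<and> P 2" for P
    by (auto simp: numeral_3_eq_3 numeral_2_eq_2 less_Suc_eq)
  have inv: "inv_into UNIV cycle3 = (\<lambda>i. if i = 0 then 2 else if i = 1 then 0 else if i = 2 then 1 else i)"
    by (rule inv_unique_comp) (auto simp: cycle3_def fun_eq_iff)
  show ?thesis
    using assms by (cases s; cases s') (simp_all add: all3 inv, simp_all add: cycle3_def)
qed

lemma perm_class_antichain:
  assumes "perm_class s \<subseteq> perm_class s'"
  shows "s = s'"
proof (rule ccontr)
  assume "s \<noteq> s'"
  have "cycle3 permutes {0..<3}"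
  proof (rule bij_imp_permutes)
    show "bij_betw cycle3 {0..<3} {0..<3}"
      by (rule bij_betw_byWitness[where f' = "\<lambda>i. if i = 0 then 2 else i - 1"])
        (auto simp: cycle3_def)
  qed (auto simp: cycle3_def)
  then have "perm_mat s 3 cycle3 \<in> perm_class s"
    unfolding perm_class_iff
    by (intro exI[of _ 3] exI[of _ cycle3] conjI ordered_submatrix_refl) simp_all
  then have "perm_mat s 3 cycle3 \<in> perm_class s'" using assms by blast
  then have "shape s' (perm_mat s 3 cycle3)"
    unfolding perm_class_iff using shape_ordered_submatrix shape_perm_mat by blast
  with not_shape_cycle3[OF \<open>s \<noteq> s'\<close>] show False by contradiction
qed

theorem corollary35:
  shows "inj perm_class \<and>
    range perm_class =
      {M. matrix_class M \<and> (\<forall>A\<in>M. zero_one_mat A) \<and> growth_exp_superlinear M \<and>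
          (\<forall>N. N \<subset> M \<and> matrix_class N \<longrightarrow> growth_exp_linear N)}"
proof (rule conjI)
  show "inj perm_class" by (rule injI) (rule perm_class_antichain, simp)
next
  show "range perm_class =
      {M. matrix_class M \<and> (\<forall>A\<in>M. zero_one_mat A) \<and> growth_exp_superlinear M \<and>
          (\<forall>N. N \<subset> M \<and> matrix_class N \<longrightarrow> growth_exp_linear N)}" (is "_ = ?minimal")
  proof (rule equalityI; rule subsetI)
    fix M :: "nat mat set" assume "M \<in> range perm_class"
    then obtain s where s: "M = perm_class s" by blast
    have "growth_exp_linear N" if N: "N \<subset> M" "matrix_class N" for N
    proof -
      have "\<forall>A\<in>N. zero_one_mat A" using N(1) zero_one_perm_class s by blast
      moreover have "\<not> perm_class s' \<subseteq> N" for s'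
      proof
        assume sub: "perm_class s' \<subseteq> N"
        then have "s' = s" using N(1) s by (intro perm_class_antichain) blast
        with sub N(1) s show False by blast
      qed
      ultimately show ?thesis using growth_dichotomy[OF N(2)] by blast
    qed
    then show "M \<in> ?minimal"
      using matrix_class_perm_class[of s] zero_one_perm_class superlinear_perm_class[of s] s by blast
  next
    fix M assume "M \<in> ?minimal"
    then have M: "matrix_class M" "\<forall>A\<in>M. zero_one_mat A" "growth_exp_superlinear M"
      "\<And>N. N \<subset> M \<Longrightarrow> matrix_class N \<Longrightarrow> growth_exp_linear N" by blast+
    obtain s where s: "perm_class s \<subseteq> M"
      using growth_dichotomy[OF M(1,2)] superlinear_not_linear[OF M(3)] by blast
    have "\<not> perm_class s \<subset> M"
      using M(4)[OF _ matrix_class_perm_class] superlinear_not_linear[OF superlinear_perm_class] by blast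
    with s have "M = perm_class s" by blast
    then show "M \<in> range perm_class" by blast
  qed
qed

end
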